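(* Let $X_t$, $t\in[0,+\infty)$, be a real process with càdlàg trajectories on a probability space $(\Omega,\mathcal{F},\mathbb{P})$, and let $\beta>0$ and a (deterministic) constant $C$ be such that for each $t\ge 0$ the convergence $$c^{1/\beta-1}\,\mathrm{TV}^{c}(X,[0,t])\to C\cdot t\quad\text{as } c\to 0+$$ holds with probability $1$. Assume that $X$ possesses a local time $L$ relative to the Lebesgue measure $\mathrm{d}y$ on $\mathbb{R}$ and the constant mapping $\Xi(\omega)\equiv \mathrm{d}u$ (the Lebesgue measure on $[0,+\infty)$). Then there exists a measurable set $\Omega_X\subset\Omega$ such that $\mathbb{P}(\Omega_X)=1$ and for each $\omega\in\Omega_X$ and each $t\in[0,+\infty)$ the measures $$c^{1/\beta-1}\,\mathrm{n}^{y,c}(X(\omega),[0,t])\,\mathrm{d}y$$ converge weakly to the measure $C\cdot L^y_t(\omega)\,\mathrm{d}y$ as $c\to 0+$.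
   Context: Truncated variation: for $x:[0,+\infty)\to\mathbb{R}$, $c\ge 0$ and $0\le s<t$, $$\mathrm{TV}^{c}(x,[s,t])=\sup_{\pi}\sum_{[u,v]\in\pi}\max(|x_v-x_u|-c,0),$$ the supremum being over all finite partitions $\pi$ of $[s,t]$ into subintervals with disjoint interiors (it is $0$ on $[0,0]$). Numbers of interval crossings of a càdlàg path $x$: for $y\in\mathbb{R}$, $c>0$, put $\sigma^c_0=s$ and for $n=0,1,2,\dots$ $$\rho^c_n=\inf\{u\in[\sigma^c_n,t]: x_u\ge y+c/2\},\qquad \sigma^c_{n+1}=\inf\{u\in[\rho^c_n,t]: x_u<y-c/2\},$$ with $\inf\emptyset=+\infty$ and $[+\infty,t]=\emptyset$. Then $\mathrm{d}^{y,c}(x,[s,t])=\max\{n:\sigma^c_n\le t\}$, $\mathrm{u}^{y,c}(x,[s,t])=\mathrm{d}^{-y,c}(-x,[s,t])$ and $\mathrm{n}^{y,c}(x,[s,t])=\mathrm{u}^{y,c}(x,[s,t])+\mathrm{d}^{y,c}(x,[s,t])$. Local time: for $\omega\in\Omega$ and $t\ge0$ let $\mu_t$ be the occupation measure $\mu_t(\Gamma)=\int_{[0,t]}\mathbf{1}_\Gamma(X_s(\omega))\,\mathrm{d}s$, $\Gamma\subset\mathbb{R}$ Borel. $X$ possesses a local time relative to $\mathrm{d}y$ and the constant mapping $\Xi(\omega)\equiv\mathrm{d}u$ if for each $t\ge 0$, $\mu_t$ is $\mathbb{P}$-a.s. absolutely continuous with respect to $\mathrm{d}y$; the local time is the density $L^y_t(\omega)=(\mathrm{d}\mu_t/\mathrm{d}y)(y)$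 (defined $\mathbb{P}$-a.s.). *)

theory Defs
  imports "HOL-Probability.Probability"
begin

text \<open>
  Paths are total functions \<^typ>\<open>real \<Rightarrow> real\<close>; only their values on $[0,\infty)$ matter.
\<close>

definition cadlag :: "(real \<Rightarrow> real) \<Rightarrow> bool" where
  "cadlag x \<longleftrightarrow>
     (\<forall>t\<ge>0. (x \<longlongrightarrow> x t) (at_right t)) \<and> (\<forall>t>0. \<exists>l. (x \<longlongrightarrow> l) (at_left t))"

text \<open>
  Finite partitions into subintervals with disjoint interiors are the divisions of the library.
  These also admit one-point subintervals, which contribute 0 to the sum.
  The supremum is taken in the extended reals, so no finiteness is presupposed.
\<close>

definition truncated_variation :: "real \<Rightarrow> (real \<Rightarrow> real) \<Rightarrow> real \<Rightarrow> real \<Rightarrow> ereal" where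
  "truncated_variation c x s t =
     (SUP \<pi>\<in>{\<pi>. \<pi> division_of {s..t}}. ereal (\<Sum>K\<in>\<pi>. max (\<bar>x (Sup K) - x (Inf K)\<bar> - c) 0))"

text \<open>
  The times $\rho^c_n$ and $\sigma^c_{n+1}$: first entry, in $[a,t]$, into
  $[y+c/2,\infty)$ and into $(-\infty,y-c/2)$ respectively. Times are extended reals, so that the
  infimum of the empty set is $\infty$ and the search interval is empty for $a=\infty$.
\<close>

definition entry_above :: "real \<Rightarrow> real \<Rightarrow> (real \<Rightarrow> real) \<Rightarrow> real \<Rightarrow> ereal \<Rightarrow> ereal" where
  "entry_above y c x t a = Inf (ereal ` {u. a \<le> ereal u \<and> u \<le> t \<and> x u \<ge> y + c / 2})"

definition entry_below :: "real \<Rightarrow> real \<Rightarrow> (real \<Rightarrow> real) \<Rightarrow> real \<Rightarrow> ereal \<Rightarrow> ereal" where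
  "entry_below y c x t a = Inf (ereal ` {u. a \<le> ereal u \<and> u \<le> t \<and> x u < y - c / 2})"

primrec downcrossing_time ::
    "real \<Rightarrow> real \<Rightarrow> (real \<Rightarrow> real) \<Rightarrow> real \<Rightarrow> real \<Rightarrow> nat \<Rightarrow> ereal" where
  "downcrossing_time y c x s t 0 = ereal s"
| "downcrossing_time y c x s t (Suc n) =
     entry_below y c x t (entry_above y c x t (downcrossing_time y c x s t n))"

text \<open>
  For a cadlag path, $c>0$ and $0\le s\le t$ the set below is finite and contains 0,
  so the maximum is meaningful.
\<close>

definition downcrossings :: "real \<Rightarrow> real \<Rightarrow> (real \<Rightarrow> real) \<Rightarrow> real \<Rightarrow> real \<Rightarrow> nat" where
  "downcrossings y c x s t = Max {n. downcrossing_time y c x s t n \<le> ereal t}"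

definition upcrossings :: "real \<Rightarrow> real \<Rightarrow> (real \<Rightarrow> real) \<Rightarrow> real \<Rightarrow> real \<Rightarrow> nat" where
  "upcrossings y c x s t = downcrossings (- y) c (\<lambda>u. - x u) s t"

definition crossings :: "real \<Rightarrow> real \<Rightarrow> (real \<Rightarrow> real) \<Rightarrow> real \<Rightarrow> real \<Rightarrow> nat" where
  "crossings y c x s t = upcrossings y c x s t + downcrossings y c x s t"

definition occupation_measure :: "(real \<Rightarrow> 'a \<Rightarrow> real) \<Rightarrow> real \<Rightarrow> 'a \<Rightarrow> real measure" where
  "occupation_measure X t \<omega> = distr (restrict_space lborel {0..t}) borel (\<lambda>s. X s \<omega>)"

definition has_local_time :: "'a measure \<Rightarrow> (real \<Rightarrow> 'a \<Rightarrow> real) \<Rightarrow> bool" where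
  "has_local_time M X \<longleftrightarrow>
     (\<forall>t\<ge>0. AE \<omega> in M. absolutely_continuous lborel (occupation_measure X t \<omega>))"

text \<open>
  The density $L^y_t(\omega)$; it is meaningful for those $\omega$ for which the occupation measure
  is absolutely continuous.
\<close>

definition local_time :: "(real \<Rightarrow> 'a \<Rightarrow> real) \<Rightarrow> real \<Rightarrow> 'a \<Rightarrow> real \<Rightarrow> ennreal" where
  "local_time X t \<omega> y = RN_deriv lborel (occupation_measure X t \<omega>) y"

text \<open>
  Weak convergence of finite Borel measures on the real line along a filter. The library's
  \<^const>\<open>weak_conv_m\<close> covers only sequences and is defined through distribution functions.
\<close>

definition weakly_converges ::
    "('i \<Rightarrow> real measure) \<Rightarrow> real measure \<Rightarrow> 'i filter \<Rightarrow> bool" where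
  "weakly_converges \<nu> \<mu> F \<longleftrightarrow>
     (\<forall>\<^sub>F i in F. finite_borel_measure (\<nu> i)) \<and> finite_borel_measure \<mu> \<and>
     (\<forall>f :: real \<Rightarrow> real. continuous_on UNIV f \<and> bounded (range f) \<longrightarrow>
        ((\<lambda>i. \<integral>y. f y \<partial>\<nu> i) \<longlongrightarrow> (\<integral>y. f y \<partial>\<mu>)) F)"

end

theory Submission
  imports Defs
begin

text \<open>
  The argument is pathwise. Write \<open>N c a b\<close> for the integral over \<open>y\<close> of the number of crossings on
  \<open>[a, b]\<close>. Superadditivity of crossing numbers gives \<open>TV c a b \<le> N c a b\<close>. Conversely, the play
  operator (the laziest path at distance at most \<open>c'/2\<close> from \<open>x\<close>) crosses the level \<open>y\<close> at least as
  often as \<open>x\<close> crosses the band of width \<open>c > c'\<close> around \<open>y\<close>, and its variation is at most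
  \<open>TV c' + c'\<close>; letting \<open>c'/c\<close> tend to 1, the total masses converge to \<open>C * t\<close>.
  Since \<open>TV c\<close> is additive over adjacent intervals up to \<open>c\<close> and \<open>c powr (1/\<beta>)\<close> vanishes, the mass
  contributed by \<open>[a, b]\<close> is asymptotically at least \<open>C * (b - a)\<close>, and it sits on the convex hull
  of the values of \<open>x\<close> on \<open>[a, b]\<close>. Cutting the time axis into intervals of small oscillation yields
  lower bounds by \<open>C\<close> times the integral of \<open>f (x s)\<close> for nonnegative \<open>f\<close>; jumps do no harm, as
  short intervals before them can be dropped. With the convergence of the total masses, lower bounds
  for \<open>B + f\<close> and \<open>B - f\<close> suffice.
\<close>

section \<open>Truncated variation\<close>

text \<open>Tagging each interval with its left endpoint turns the division into a tagged one, over
  which the increments of \<open>g\<close> telescope.\<close>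

lemma division_sum_le_increment:
  fixes g :: "real \<Rightarrow> real"
  assumes div: "\<pi> division_of {a..b}" and ab: "a \<le> b"
    and F: "\<And>u v. a \<le> u \<Longrightarrow> u \<le> v \<Longrightarrow> v \<le> b \<Longrightarrow> F u v \<le> g v - g u"
  shows "(\<Sum>K\<in>\<pi>. F (Inf K) (Sup K)) \<le> g b - g a"
proof -
  have intv: "\<exists>u v. K = {u..v} \<and> a \<le> u \<and> u \<le> v \<and> v \<le> b" if K_in: "K \<in> \<pi>" for K
  proof -
    obtain u v where K: "K = cbox u v" using division_ofD(4)[OF div K_in] by blast
    moreover have "K \<noteq> {}" "K \<subseteq> {a..b}"
      using division_ofD(2,3)[OF div K_in] by auto
    ultimately show ?thesis by (intro exI[of _ u] exI[of _ v]) auto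
  qed
  define p where "p = (\<lambda>K. (Inf K, K)) ` \<pi>"
  have tag: "p tagged_division_of {a..b}"
  proof (rule tagged_division_ofI)
    show "finite p" using division_ofD(1)[OF div] by (simp add: p_def)
    show "\<And>x K. (x, K) \<in> p \<Longrightarrow> x \<in> K" using intv by (fastforce simp: p_def)
    show "\<And>x K. (x, K) \<in> p \<Longrightarrow> K \<subseteq> {a..b}" using division_ofD(2)[OF div] by (auto simp: p_def)
    show "\<And>x K. (x, K) \<in> p \<Longrightarrow> \<exists>a b. K = cbox a b"
      using division_ofD(4)[OF div] by (auto simp: p_def)
    show "interior K1 \<inter> interior K2 = {}"
      if "(x1, K1) \<in> p" "(x2, K2) \<in> p" "(x1, K1) \<noteq> (x2, K2)" for x1 K1 x2 K2
      using that division_ofD(5)[OF div] by (auto simp: p_def)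
    show "\<Union> {K. \<exists>x. (x, K) \<in> p} = {a..b}"
      using division_ofD(6)[OF div] by (auto simp: p_def image_iff)
  qed
  have "(\<Sum>K\<in>\<pi>. F (Inf K) (Sup K)) \<le> (\<Sum>K\<in>\<pi>. g (Sup K) - g (Inf K))"
  proof (rule sum_mono)
    fix K assume "K \<in> \<pi>"
    then obtain u v where "K = {u..v}" "a \<le> u" "u \<le> v" "v \<le> b" using intv by blast
    then show "F (Inf K) (Sup K) \<le> g (Sup K) - g (Inf K)" using F by simp
  qed
  also have "\<dots> = (\<Sum>(x, K)\<in>p. g (Sup K) - g (Inf K))"
    unfolding p_def by (subst sum.reindex) (auto simp: inj_on_def)
  also have "\<dots> = g b - g a"
    using additive_tagged_division_1[OF ab tag, of g] by simp
  finally show ?thesis .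
qed

definition excess :: "real \<Rightarrow> (real \<Rightarrow> real) \<Rightarrow> real \<Rightarrow> real \<Rightarrow> real" where
  "excess c x u v = max (\<bar>x v - x u\<bar> - c) 0"

lemma excess_nonneg: "0 \<le> excess c x u v"
  by (simp add: excess_def)

lemma excess_same: "0 \<le> c \<Longrightarrow> excess c x u u = 0"
  by (simp add: excess_def)

lemma truncated_variation_excess:
  "truncated_variation c x s t =
     (SUP \<pi>\<in>{\<pi>. \<pi> division_of {s..t}}. ereal (\<Sum>K\<in>\<pi>. excess c x (Inf K) (Sup K)))"
  by (simp add: truncated_variation_def excess_def)

text \<open>Upper bounds come from a control function \<open>g\<close> whose increments dominate the
  excesses. Below, \<open>g\<close> is built from running truncated variations or from running
  crossing integrals.\<close>

lemma truncated_variation_le: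
  assumes "a \<le> b"
    and "\<And>u v. a \<le> u \<Longrightarrow> u \<le> v \<Longrightarrow> v \<le> b \<Longrightarrow> excess c x u v \<le> g v - g u"
  shows "truncated_variation c x a b \<le> ereal (g b - g a)"
  unfolding truncated_variation_excess
  by (rule SUP_least) (use division_sum_le_increment[of _ a b "excess c x" g] assms in auto)

lemma truncated_variation_nonneg:
  assumes "a \<le> b" shows "0 \<le> truncated_variation c x a b"
proof -
  have "{{a..b}} division_of {a..b}" using assms division_of_self[of a b] by simp
  then have "ereal (\<Sum>K\<in>{{a..b}}. excess c x (Inf K) (Sup K)) \<le> truncated_variation c x a b"
    unfolding truncated_variation_excess by (intro SUP_upper) auto
  moreover have "0 \<le> ereal (\<Sum>K\<in>{{a..b}}. excess c x (Inf K) (Sup K))"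
    using excess_nonneg by simp
  ultimately show ?thesis by (rule order_trans[rotated])
qed

text \<open>Appending \<open>{u..v}\<close> to a division of \<open>{a..u}\<close> gives one of
  \<open>{a..v}\<close>. Thus the running truncated variation is itself a control function for the
  excesses.\<close>

lemma truncated_variation_add_excess:
  assumes c: "0 \<le> c" and au: "a \<le> u" and uv: "u \<le> v"
  shows "truncated_variation c x a u + ereal (excess c x u v) \<le> truncated_variation c x a v"
proof -
  have ne: "{\<pi>. \<pi> division_of {a..u}} \<noteq> {}"
    using division_of_self[of a u] au by auto
  have "truncated_variation c x a u + ereal (excess c x u v) =
      (SUP \<pi>\<in>{\<pi>. \<pi> division_of {a..u}}. ereal (\<Sum>K\<in>\<pi>. excess c x (Inf K) (Sup K)) + ereal (excess c x u v))"
    unfolding truncated_variation_excess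
    by (subst SUP_ereal_add_left) (use ne excess_nonneg in auto)
  also have "\<dots> \<le> truncated_variation c x a v"
  proof (rule SUP_least, clarify)
    fix \<pi> assume div: "\<pi> division_of {a..u}"
    have "{{u..v}} division_of {u..v}" using uv division_of_self[of u v] by simp
    then have "\<pi> \<union> {{u..v}} division_of {a..u} \<union> {u..v}"
      by (intro division_disjoint_union[OF div]) (use au uv in \<open>auto simp: interior_atLeastAtMost_real\<close>)
    then have div': "\<pi> \<union> {{u..v}} division_of {a..v}"
      using au uv by (simp add: ivl_disj_un_two_touch)
    have "(\<Sum>K\<in>\<pi>. excess c x (Inf K) (Sup K)) + excess c x u v
        \<le> (\<Sum>K\<in>\<pi> \<union> {{u..v}}. excess c x (Inf K) (Sup K))"
    \<comment> \<open>The union would lose the new summand if \<open>{u..v}\<close> were already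
      present; this forces \<open>u = v\<close>, and then the excess is 0.\<close>
    proof (cases "{u..v} \<in> \<pi>")
      case True
      then have "{u..v} \<subseteq> {a..u}" using div by blast
      with uv have "u = v" by auto
      then show ?thesis using True c by (simp add: insert_absorb excess_same)
    next
      case False
      then show ?thesis using uv division_of_finite[OF div] by simp
    qed
    then have "ereal (\<Sum>K\<in>\<pi>. excess c x (Inf K) (Sup K)) + ereal (excess c x u v)
        \<le> ereal (\<Sum>K\<in>\<pi> \<union> {{u..v}}. excess c x (Inf K) (Sup K))" by simp
    also have "\<dots> \<le> truncated_variation c x a v"
      unfolding truncated_variation_excess by (rule SUP_upper) (use div' in simp)
    finally show "ereal (\<Sum>K\<in>\<pi>. excess c x (Inf K) (Sup K)) + ereal (excess c x u v)
        \<le> truncated_variation c x a v" .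
  qed
  finally show ?thesis .
qed

lemma truncated_variation_mono:
  assumes "0 \<le> c" "a \<le> u" "u \<le> v"
  shows "truncated_variation c x a u \<le> truncated_variation c x a v"
proof -
  have "truncated_variation c x a u + 0 \<le> truncated_variation c x a u + ereal (excess c x u v)"
    using excess_nonneg by (intro add_mono) auto
  then show ?thesis using truncated_variation_add_excess[OF assms, of x] by simp
qed

lemma truncated_variation_real:
  assumes "0 \<le> c" "a \<le> u" "u \<le> T" "truncated_variation c x a T < \<infinity>"
  shows "truncated_variation c x a u = ereal (real_of_ereal (truncated_variation c x a u))"
proof -
  have "truncated_variation c x a u \<noteq> \<infinity>" 
    using truncated_variation_mono[of c a u T x] assms by auto
  then show ?thesis
    using truncated_variation_nonneg[of a u c x] assms by (cases "truncated_variation c x a u") auto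
qed

text \<open>Only an interval straddling \<open>b\<close> causes a loss: cutting it at
  \<open>b\<close> subtracts the threshold twice instead of once, which costs at most
  \<open>c\<close> by the triangle inequality.\<close>

lemma truncated_variation_split:
  assumes c: "0 \<le> c" and ab: "a \<le> b" and bd: "b \<le> d"
  shows "truncated_variation c x a d \<le> truncated_variation c x a b + truncated_variation c x b d + ereal c"
proof (cases "truncated_variation c x a b < \<infinity> \<and> truncated_variation c x b d < \<infinity>")
  case False
  moreover have "0 \<le> truncated_variation c x a b" "0 \<le> truncated_variation c x b d"
    using ab bd by (simp_all add: truncated_variation_nonneg)
  ultimately have "truncated_variation c x a b + truncated_variation c x b d = \<infinity>"
    by (cases "truncated_variation c x a b"; cases "truncated_variation c x b d") auto
  then show ?thesis by (metis ereal_less_eq(1) plus_ereal.simps(2))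
next
  case True
  define p where "p u = real_of_ereal (truncated_variation c x a u)" for u
  define q where "q u = real_of_ereal (truncated_variation c x b u)" for u
  have p: "truncated_variation c x a u = ereal (p u)" if "a \<le> u" "u \<le> b" for u
    unfolding p_def using truncated_variation_real[of c a u b x] that True c by auto
  have q: "truncated_variation c x b u = ereal (q u)" if "b \<le> u" "u \<le> d" for u
    unfolding q_def using truncated_variation_real[of c b u d x] that True c by auto
  have pi: "p u + excess c x u v \<le> p v" if "a \<le> u" "u \<le> v" "v \<le> b" for u v
    using truncated_variation_add_excess[OF c that(1,2), of x] p[of u] p[of v] that by simp
  have qi: "q u + excess c x u v \<le> q v" if "b \<le> u" "u \<le> v" "v \<le> d" for u v
    using truncated_variation_add_excess[OF c that(1,2), of x] q[of u] q[of v] that by simp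
  have p0: "0 \<le> p a" using p[of a] truncated_variation_nonneg[of a a c x] ab by simp
  have q0: "0 \<le> q b" using q[of b] truncated_variation_nonneg[of b b c x] bd by simp
  \<comment> \<open>The extra \<open>c\<close> beyond \<open>b\<close> pays for an interval that
    straddles \<open>b\<close>.\<close>
  define g where "g u = (if u \<le> b then p u else p b + q u + c)" for u
  have "excess c x u v \<le> g v - g u" if "a \<le> u" "u \<le> v" "v \<le> d" for u v
  proof -
    consider "v \<le> b" | "b < u" | "u \<le> b" "b < v" by linarith
    then show ?thesis
    proof cases
      case 1 then show ?thesis using pi[of u v] that by (simp add: g_def)
    next
      case 2 then show ?thesis using qi[of u v] that by (simp add: g_def)
    next
      case 3
      have "excess c x u v \<le> excess c x u b + excess c x b v + c"
        unfolding excess_def using c by linarith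
      then show ?thesis using 3 pi[of u b] qi[of b v] that bd q0 by (simp add: g_def)
    qed
  qed
  then have "truncated_variation c x a d \<le> ereal (g d - g a)"
    using ab bd by (intro truncated_variation_le) auto
  also have "g d - g a \<le> p b + q d + c"
    using p0 q0 ab bd c qi[of b b] qi[of b d] excess_nonneg[of c x b d] by (auto simp: g_def)
  finally show ?thesis using p[of b] q[of d] ab bd by simp
qed

section \<open>Counting drops through a band\<close>

text \<open>The times are only required to exist, rather than being first entries, so that runs of
  drops can be concatenated and moved. The set \<open>S\<close> of admissible times will be a
  half-line or a finite grid. The recursion splits off the last drop.\<close>

primrec drops :: "real set \<Rightarrow> real \<Rightarrow> real \<Rightarrow> (real \<Rightarrow> real) \<Rightarrow> nat \<Rightarrow> real \<Rightarrow> bool" where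
  "drops S hi lo x 0 \<tau> \<longleftrightarrow> True"
| "drops S hi lo x (Suc k) \<tau> \<longleftrightarrow>
     (\<exists>a\<in>S. \<exists>b\<in>S. drops S hi lo x k a \<and> a \<le> b \<and> b \<le> \<tau> \<and> hi \<le> x a \<and> x b < lo)"

lemma drops_SucI:
  "drops S hi lo x k a \<Longrightarrow> a \<in> S \<Longrightarrow> b \<in> S \<Longrightarrow> a \<le> b \<Longrightarrow> b \<le> \<tau> \<Longrightarrow> hi \<le> x a \<Longrightarrow> x b < lo \<Longrightarrow>
     drops S hi lo x (Suc k) \<tau>"
  by auto

lemma drops_mono: "drops S hi lo x k \<tau> \<Longrightarrow> \<tau> \<le> \<tau>' \<Longrightarrow> drops S hi lo x k \<tau>'"
  by (cases k) (auto intro: order_trans)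

lemma drops_subset: "drops S hi lo x k \<tau> \<Longrightarrow> S \<subseteq> S' \<Longrightarrow> drops S' hi lo x k \<tau>"
  by (induction k arbitrary: \<tau>) (simp, fastforce)

lemma drops_append:
  assumes "drops {s..} hi lo x k r" "s \<le> r"
  shows "drops {r..} hi lo x l t \<Longrightarrow> r \<le> t \<Longrightarrow> drops {s..} hi lo x (k + l) t"
proof (induction l arbitrary: t)
  case 0
  then show ?case using drops_mono[OF assms(1)] by simp
next
  case (Suc l)
  then obtain a b where ab: "r \<le> a" "drops {r..} hi lo x l a" "a \<le> b" "b \<le> t" "hi \<le> x a" "x b < lo"
    by auto
  have "drops {s..} hi lo x (k + l) a" using Suc.IH ab by blast
  moreover have "a \<in> {s..}" "b \<in> {s..}" using ab assms(2) by auto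
  ultimately have "drops {s..} hi lo x (Suc (k + l)) t" using ab by (intro drops_SucI[of _ _ _ _ _ a b])
  then show ?case by simp
qed

text \<open>Lowering the level keeps \<open>x a\<close> above the upper barrier, while the strict
  inequality for \<open>x b\<close> leaves the room \<open>y - h - x b\<close>. Finitely many drops
  share a positive margin.\<close>

lemma drops_open_left:
  "drops S (y + h) (y - h) x k \<tau> \<Longrightarrow> \<exists>e>0. \<forall>z\<in>{y - e<..y}. drops S (z + h) (z - h) x k \<tau>"
proof (induction k arbitrary: \<tau>)
  case 0
  then show ?case by (auto intro: exI[of _ 1])
next
  case (Suc k)
  then obtain a b where ab: "a \<in> S" "b \<in> S" "drops S (y + h) (y - h) x k a" "a \<le> b" "b \<le> \<tau>"
    "y + h \<le> x a" "x b < y - h" by auto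
  obtain e where e: "e > 0" "\<forall>z\<in>{y - e<..y}. drops S (z + h) (z - h) x k a"
    using Suc.IH ab(3) by blast
  show ?case
  proof (intro exI[of _ "min e (y - h - x b)"] conjI ballI)
    show "0 < min e (y - h - x b)" using e ab by simp
  next
    fix z assume z: "z \<in> {y - min e (y - h - x b)<..y}"
    then have "z \<in> {y - e<..y}" "x b < z - h" "z + h \<le> x a" using ab by auto
    then show "drops S (z + h) (z - h) x (Suc k) \<tau>"
      using e ab by (intro drops_SucI[of _ _ _ _ _ a b]) auto
  qed
qed

text \<open>Such a set is a countable union of intervals: every point \<open>y\<close> of it lies in
  \<open>J q\<close> for some rational \<open>q\<close> slightly to its left.\<close>

lemma borel_if_open_left:
  fixes S :: "real set"
  assumes "\<And>y. y \<in> S \<Longrightarrow> \<exists>e>0. {y - e<..y} \<subseteq> S"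
  shows "S \<in> sets borel"
proof -
  define J where "J q = {y. q \<le> y \<and> {q..y} \<subseteq> S}" for q
  have "is_interval (J q)" for q
  proof -
    have "z \<in> J q" if "u \<in> J q" "v \<in> J q" "u \<le> z" "z \<le> v" for u v z
    proof -
      have "{q..z} \<subseteq> {q..v}" using that by auto
      then show ?thesis using that by (auto simp: J_def)
    qed
    then show ?thesis unfolding is_interval_1 by blast
  qed
  then have J: "J q \<in> sets borel" for q by (rule real_interval_borel_measurable)
  have "S = (\<Union>q\<in>\<rat>. J q)"
  proof (intro equalityI subsetI)
    fix y assume "y \<in> S"
    then obtain e where e: "e > 0" "{y - e<..y} \<subseteq> S" using assms by blast
    obtain q where "q \<in> \<rat>" "y - e < q" "q < y" using Rats_dense_in_real[of "y - e" y] e by auto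
    moreover from this have "{q..y} \<subseteq> {y - e<..y}" by auto
    ultimately show "y \<in> (\<Union>q\<in>\<rat>. J q)" using e by (auto simp: J_def intro!: bexI[of _ q])
  qed (auto simp: J_def)
  also have "\<dots> \<in> sets borel" using J countable_rat by (intro sets.countable_UN'') auto
  finally show ?thesis .
qed

lemma drops_borel: "{y. drops S (y + h) (y - h) x k \<tau>} \<in> sets borel"
  by (rule borel_if_open_left) (use drops_open_left in blast)

text \<open>
  Counting with a supremum in \<^typ>\<open>ennreal\<close> makes superadditivity and measurability hold without
  any finiteness assumption.
\<close>

definition ndrops :: "real \<Rightarrow> (real \<Rightarrow> real) \<Rightarrow> real \<Rightarrow> real \<Rightarrow> real \<Rightarrow> ennreal" where
  "ndrops c x s t y = (SUP k\<in>{k. drops {s..} (y + c/2) (y - c/2) x k t}. of_nat k)"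

lemma ndrops_measurable [measurable]: "ndrops c x s t \<in> borel_measurable borel"
proof -
  \<comment> \<open>The index set of the supremum depends on \<open>y\<close>. Indicators replace it
    by all naturals, so that measurability for each fixed \<open>k\<close> suffices.\<close>
  have "ndrops c x s t = (\<lambda>y. SUP k. of_nat k * indicator {y. drops {s..} (y + c/2) (y - c/2) x k t} y)"
    unfolding ndrops_def
  proof (intro ext antisym SUP_least)
    fix y k assume "k \<in> {k. drops {s..} (y + c/2) (y - c/2) x k t}"
    then show "of_nat k \<le> (SUP k. of_nat k * indicator {y. drops {s..} (y + c/2) (y - c/2) x k t} y :: ennreal)"
      by (intro SUP_upper2[of k]) auto
  next
    fix y k
    show "of_nat k * indicator {y. drops {s..} (y + c/2) (y - c/2) x k t} y \<le>
        (SUP k\<in>{k. drops {s..} (y + c/2) (y - c/2) x k t}. of_nat k :: ennreal)"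
      by (auto split: split_indicator intro: SUP_upper)
  qed
  then show ?thesis using drops_borel[of "{s..}" "c/2" x _ t] by simp
qed

lemma SUP_add_SUP_le:
  fixes f g :: "_ \<Rightarrow> ennreal"
  assumes "A \<noteq> {}" "B \<noteq> {}" and le: "\<And>k l. k \<in> A \<Longrightarrow> l \<in> B \<Longrightarrow> f k + g l \<le> z"
  shows "(SUP k\<in>A. f k) + (SUP l\<in>B. g l) \<le> z"
proof -
  have "f k + (SUP l\<in>B. g l) \<le> z" if "k \<in> A" for k
  proof -
    have "(SUP l\<in>B. g l + f k) \<le> z"
      using le[OF that] by (intro SUP_least) (metis add.commute)
    then show ?thesis by (subst add.commute) (simp only: ennreal_SUP_add_left[OF assms(2)])
  qed
  then have "(SUP k\<in>A. f k + (SUP l\<in>B. g l)) \<le> z" by (intro SUP_least)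
  then show ?thesis by (simp only: ennreal_SUP_add_left[OF assms(1)])
qed

lemma ndrops_superadd:
  assumes "s \<le> r" "r \<le> t"
  shows "ndrops c x s r y + ndrops c x r t y \<le> ndrops c x s t y"
  unfolding ndrops_def
proof (rule SUP_add_SUP_le)
  fix k l
  assume "k \<in> {k. drops {s..} (y + c/2) (y - c/2) x k r}" "l \<in> {k. drops {r..} (y + c/2) (y - c/2) x k t}"
  then have "k + l \<in> {k. drops {s..} (y + c/2) (y - c/2) x k t}"
    using drops_append[of s "y + c/2" "y - c/2" x k r l t] assms by simp
  then have "of_nat (k + l) \<le> (SUP k\<in>{k. drops {s..} (y + c/2) (y - c/2) x k t}. of_nat k :: ennreal)"
    by (rule SUP_upper)
  then show "of_nat k + of_nat l \<le> (SUP k\<in>{k. drops {s..} (y + c/2) (y - c/2) x k t}. of_nat k :: ennreal)"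
    by simp
qed (auto intro: exI[of _ 0])

lemma ndrops_ge_1:
  assumes "s \<le> t" "y + c/2 \<le> x s" "x t < y - c/2"
  shows "1 \<le> ndrops c x s t y"
proof -
  have "drops {s..} (y + c/2) (y - c/2) x (Suc 0) t"
    using assms by auto
  then show ?thesis unfolding ndrops_def by (intro SUP_upper2[of "Suc 0"]) auto
qed

lemma ndrops_eq_0:
  assumes "0 \<le> c" and "\<And>a b. s \<le> a \<Longrightarrow> a \<le> b \<Longrightarrow> b \<le> t \<Longrightarrow> y \<le> x a \<Longrightarrow> x b \<le> y \<Longrightarrow> False"
  shows "ndrops c x s t y = 0"
proof -
  have "k = 0" if k: "drops {s..} (y + c/2) (y - c/2) x k t" for k
  proof (cases k)
    case (Suc l)
    then obtain a b where "s \<le> a" "a \<le> b" "b \<le> t" "y + c/2 \<le> x a" "x b < y - c/2"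
      using k by auto
    then show ?thesis using assms(1) assms(2)[of a b] by auto
  qed
  then show ?thesis unfolding ndrops_def by (auto intro!: antisym SUP_least)
qed

lemma ndrops_mono:
  assumes "s \<le> s'" "s' \<le> t'" "t' \<le> t"
  shows "ndrops c x s' t' y \<le> ndrops c x s t y"
proof -
  have "{k. drops {s'..} (y + c/2) (y - c/2) x k t'} \<subseteq> {k. drops {s..} (y + c/2) (y - c/2) x k t}"
    using drops_subset[of "{s'..}" _ _ x _ t' "{s..}"] drops_mono[of "{s..}" _ _ x _ t' t] assms by auto
  then show ?thesis unfolding ndrops_def by (intro SUP_subset_mono) auto
qed

definition ncross :: "real \<Rightarrow> (real \<Rightarrow> real) \<Rightarrow> real \<Rightarrow> real \<Rightarrow> real \<Rightarrow> ennreal" where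
  "ncross c x s t y = ndrops c (\<lambda>u. - x u) s t (- y) + ndrops c x s t y"

lemma ncross_measurable [measurable]: "ncross c x s t \<in> borel_measurable borel"
  unfolding ncross_def by measurable

lemma ncross_superadd:
  assumes "s \<le> r" "r \<le> t"
  shows "ncross c x s r y + ncross c x r t y \<le> ncross c x s t y"
proof -
  have "ncross c x s r y + ncross c x r t y =
      (ndrops c (\<lambda>u. - x u) s r (- y) + ndrops c (\<lambda>u. - x u) r t (- y)) + (ndrops c x s r y + ndrops c x r t y)"
    by (simp add: ncross_def ac_simps)
  also have "\<dots> \<le> ncross c x s t y"
    unfolding ncross_def using assms by (intro add_mono ndrops_superadd)
  finally show ?thesis .
qed

lemma ncross_mono:
  "s \<le> s' \<Longrightarrow> s' \<le> t' \<Longrightarrow> t' \<le> t \<Longrightarrow> ncross c x s' t' y \<le> ncross c x s t y"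
  unfolding ncross_def by (intro add_mono ndrops_mono)

lemma ncross_eq_0:
  assumes "0 \<le> c" "x ` {s..t} \<subseteq> I" "is_interval I" "y \<notin> I"
  shows "ncross c x s t y = 0"
proof -
  have no: "False" if "s \<le> a" "s \<le> b" "a \<le> t" "b \<le> t" "y \<le> x a" "x b \<le> y" for a b
  proof -
    have "x a \<in> I" "x b \<in> I" using that assms(2) by auto
    then show False using assms(3,4) that unfolding is_interval_1 by blast
  qed
  have "ndrops c (\<lambda>u. - x u) s t (- y) = 0"
  proof (rule ndrops_eq_0[OF assms(1)])
    fix a b assume "s \<le> a" "a \<le> b" "b \<le> t" "- y \<le> - x a" "- x b \<le> - y"
    then show False using no[of b a] by simp
  qed
  moreover have "ndrops c x s t y = 0"
  proof (rule ndrops_eq_0[OF assms(1)])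
    fix a b assume "s \<le> a" "a \<le> b" "b \<le> t" "y \<le> x a" "x b \<le> y"
    then show False using no[of a b] by simp
  qed
  ultimately show ?thesis by (simp add: ncross_def)
qed

text \<open>Levels between \<open>x s\<close> and \<open>x t\<close>, at distance more than
  \<open>c/2\<close> from both, are crossed because of the endpoint values alone. Up to endpoints
  they form an interval whose length is the excess.\<close>

lemma excess_le_integral_ncross:
  assumes "s \<le> t"
  shows "ennreal (excess c x s t) \<le> (\<integral>\<^sup>+y. ncross c x s t y \<partial>lborel)"
proof -
  consider "\<bar>x t - x s\<bar> \<le> c" | "x s \<le> x t" "c < x t - x s" | "x t \<le> x s" "c < x s - x t"
    by linarith
  then show ?thesis
  proof cases
    case 1
    then show ?thesis by (simp add: excess_def)
  next
    case 2
    then have "ennreal (excess c x s t) = (\<integral>\<^sup>+y. indicator {x s + c/2..<x t - c/2} y \<partial>lborel)"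
      by (simp add: excess_def)
    also have "\<dots> \<le> (\<integral>\<^sup>+y. ncross c x s t y \<partial>lborel)"
    proof (rule nn_integral_mono)
      fix y show "indicator {x s + c/2..<x t - c/2} y \<le> ncross c x s t y"
        using ndrops_ge_1[OF assms, of "- y" c "\<lambda>u. - x u"]
        by (cases "y \<in> {x s + c/2..<x t - c/2}") (simp_all add: ncross_def add_increasing2)
    qed
    finally show ?thesis .
  next
    case 3
    then have "ennreal (excess c x s t) = (\<integral>\<^sup>+y. indicator {x t + c/2<..x s - c/2} y \<partial>lborel)"
      by (simp add: excess_def)
    also have "\<dots> \<le> (\<integral>\<^sup>+y. ncross c x s t y \<partial>lborel)"
    proof (rule nn_integral_mono)
      fix y show "indicator {x t + c/2<..x s - c/2} y \<le> ncross c x s t y"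
        using ndrops_ge_1[OF assms, of y c x]
        by (cases "y \<in> {x t + c/2<..x s - c/2}") (simp_all add: ncross_def add_increasing)
    qed
    finally show ?thesis .
  qed
qed

section \<open>Crossing integrals and truncated variation\<close>

text \<open>By superadditivity in time, the crossing integral \<open>N a u\<close> as a function of
  \<open>u\<close> is a control function for the excesses.\<close>

lemma truncated_variation_le_integral_ncross:
  assumes ab: "a \<le> b"
  shows "truncated_variation c x a b \<le> enn2ereal (\<integral>\<^sup>+y. ncross c x a b y \<partial>lborel)"
proof (cases "(\<integral>\<^sup>+y. ncross c x a b y \<partial>lborel) = \<infinity>")
  case True
  then show ?thesis by simp
next
  case False
  define N where "N u v = (\<integral>\<^sup>+y. ncross c x u v y \<partial>lborel)" for u v
  have fin: "N a u < \<infinity>" if "a \<le> u" "u \<le> b" for u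
  proof -
    have "N a u \<le> N a b" unfolding N_def using that by (intro nn_integral_mono ncross_mono) auto
    also have "\<dots> < \<infinity>" using False by (simp add: N_def less_top)
    finally show ?thesis .
  qed
  have "excess c x u v \<le> enn2real (N a v) - enn2real (N a u)" if "a \<le> u" "u \<le> v" "v \<le> b" for u v
  proof -
    have "N a u + ennreal (excess c x u v) \<le> N a u + N u v"
      unfolding N_def using that by (intro add_left_mono excess_le_integral_ncross)
    also have "\<dots> = (\<integral>\<^sup>+y. ncross c x a u y + ncross c x u v y \<partial>lborel)"
      unfolding N_def by (rule nn_integral_add[symmetric]) auto
    also have "\<dots> \<le> N a v" unfolding N_def using that by (intro nn_integral_mono ncross_superadd)
    finally have "enn2real (N a u + ennreal (excess c x u v)) \<le> enn2real (N a v)"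
      using fin[of v] that by (intro enn2real_mono) auto
    then show ?thesis using fin[of u] that excess_nonneg[of c x u v] by (simp add: enn2real_plus)
  qed
  then have "truncated_variation c x a b \<le> ereal (enn2real (N a b) - enn2real (N a a))"
    by (intro truncated_variation_le[OF ab])
  also have "\<dots> \<le> ereal (enn2real (N a b))" by simp
  also have "\<dots> = enn2ereal (N a b)"
    using fin[of b] ab by (metis enn2ereal_ennreal enn2real_nonneg ennreal_enn2real infinity_ennreal_def order_refl)
  finally show ?thesis by (simp add: N_def)
qed

text \<open>
  The play operator: the laziest sequence staying within distance \<open>h\<close> of \<open>z\<close>. Its variation is the
  truncated variation of \<open>z\<close> at \<open>2 * h\<close> up to a constant, and each crossing by \<open>z\<close> of a band of
  width \<open>2 * h\<close> forces it to cross the middle of the band.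
\<close>

primrec play :: "real \<Rightarrow> (nat \<Rightarrow> real) \<Rightarrow> nat \<Rightarrow> real" where
  "play h z 0 = z 0"
| "play h z (Suc i) = max (z (Suc i) - h) (min (z (Suc i) + h) (play h z i))"

lemma play_bounds: "0 \<le> h \<Longrightarrow> z i - h \<le> play h z i \<and> play h z i \<le> z i + h"
  by (cases i) auto

lemma play_uminus: "0 \<le> h \<Longrightarrow> play h (\<lambda>i. - z i) i = - play h z i"
  by (induction i) (auto simp: max_def min_def)

text \<open>\<open>W\<close> will be the running truncated variation at threshold
  \<open>2 * h\<close>, read at the sample times. Between two changes of direction the play moves by
  the increment of \<open>z\<close> less \<open>2 * h\<close>, which \<open>W\<close> pays
  for.\<close>

lemma play_variation:
  assumes h: "0 \<le> h" and W0: "0 \<le> W 0"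
    and W: "\<And>i j. i \<le> j \<Longrightarrow> j \<le> m \<Longrightarrow> W i + max (\<bar>z j - z i\<bar> - 2 * h) 0 \<le> W j"
  shows "(\<Sum>i<m. \<bar>play h z (Suc i) - play h z i\<bar>) \<le> W m + 2 * h"
proof -
  have W1: "W i + \<bar>z j - z i\<bar> - 2 * h \<le> W j" if "i \<le> j" "j \<le> m" for i j
    using W[OF that] by linarith
  define U where "U m = (\<Sum>i<m. \<bar>play h z (Suc i) - play h z i\<bar>)" for m
  \<comment> \<open>Invariant with two witnesses. An upward push adds the same amount to
    \<open>U\<close> and to the right side of the first bound, whose witness stays. The second bound
    is renewed with witness \<open>Suc n\<close>, because the play then sits exactly
    \<open>h\<close> below \<open>z (Suc n)\<close>. A downward push exchanges the roles.\<close>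
  have "n \<le> m \<Longrightarrow> (\<exists>i\<le>n. U n \<le> W i - z i + play h z n) \<and> (\<exists>i\<le>n. U n \<le> W i + z i - play h z n)" for n
  proof (induction n)
    case 0
    then show ?case using W0 by (simp add: U_def)
  next
    case (Suc n)
    obtain i where i: "i \<le> n" "U n \<le> W i - z i + play h z n" using Suc.IH Suc.prems by auto
    obtain j where j: "j \<le> n" "U n \<le> W j + z j - play h z n" using Suc.IH Suc.prems by auto
    let ?p = "play h z n" and ?q = "play h z (Suc n)"
    have U: "U (Suc n) = U n + \<bar>?q - ?p\<bar>" by (simp add: U_def)
    consider "?q = ?p" | "?p < ?q" "?q = z (Suc n) - h" | "?q < ?p" "?q = z (Suc n) + h"
      using h by (cases "z (Suc n) + h \<le> ?p"; cases "?p \<le> z (Suc n) - h") force+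
    then show ?case
    proof cases
      case 1
      then show ?thesis using i j U by (intro conjI exI[of _ i] exI[of _ j]) auto
    next
      case 2
      have "U (Suc n) \<le> W (Suc n) + z (Suc n) - ?q"
        using W1[of i "Suc n"] Suc.prems i 2 U by linarith
      moreover have "U (Suc n) \<le> W i - z i + ?q" using i 2 U by linarith
      ultimately show ?thesis using i(1) by (meson le_Suc_eq order_refl)
    next
      case 3
      have "U (Suc n) \<le> W (Suc n) - z (Suc n) + ?q"
        using W1[of j "Suc n"] Suc.prems j 3 U by linarith
      moreover have "U (Suc n) \<le> W j + z j - ?q" using j 3 U by linarith
      ultimately show ?thesis using j(1) by (meson le_Suc_eq order_refl)
    qed
  qed
  then obtain i j where "i \<le> m" "U m \<le> W i - z i + play h z m" "j \<le> m" "U m \<le> W j + z j - play h z m"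
    by (metis order_refl)
  moreover from this have "W i + \<bar>z m - z i\<bar> - 2 * h \<le> W m" "W j + \<bar>z m - z j\<bar> - 2 * h \<le> W m"
    using W1 by auto
  \<comment> \<open>With both witnesses moved to \<open>m\<close>, the term
    \<open>play h z m - z m\<close> enters the two bounds with opposite signs; adding them removes
    it.\<close>
  ultimately have "U m \<le> W m + 2 * h" by linarith
  then show ?thesis by (simp add: U_def)
qed

lemma descent_ge_1:
  fixes p :: "nat \<Rightarrow> real"
  assumes "a \<le> b" "y < p a" "p b \<le> y"
  shows "1 \<le> (\<Sum>i\<in>{a..<b}. indicator {p (Suc i)..<p i} y :: ennreal)"
proof -
  have "\<exists>i\<in>{a..<b}. p (Suc i) \<le> y \<and> y < p i"
    using assms
  proof (induction b rule: dec_induct)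
    case base
    then show ?case by simp
  next
    case (step n)
    then show ?case by (cases "p n \<le> y") force+
  qed
  then obtain i where "i \<in> {a..<b}" "y \<in> {p (Suc i)..<p i}" by auto
  then show ?thesis
    using member_le_sum[of i "{a..<b}" "\<lambda>i. indicator {p (Suc i)..<p i} y :: ennreal"] by simp
qed

text \<open>The play stays within \<open>h\<close> of the samples, hence it is above
  \<open>y\<close> when a drop starts and not above \<open>y\<close> when it ends. Successive drops
  occupy disjoint blocks of steps, each containing a descent through \<open>y\<close>.\<close>

lemma drops_le_play_descents:
  assumes h: "0 \<le> h" and \<tau>: "strict_mono \<tau>" and hi: "y + h < hi" and lo: "lo \<le> y - h"
  shows "drops (\<tau> ` A) hi lo x k (\<tau> j) \<Longrightarrow>
    of_nat k \<le> (\<Sum>i<j. indicator {play h (x \<circ> \<tau>) (Suc i)..<play h (x \<circ> \<tau>) i} y :: ennreal)"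
proof (induction k arbitrary: j)
  case 0
  then show ?case by simp
next
  case (Suc k)
  let ?p = "play h (x \<circ> \<tau>)"
  let ?I = "\<lambda>i. indicator {?p (Suc i)..<?p i} y :: ennreal"
  obtain a b where ab: "drops (\<tau> ` A) hi lo x k (\<tau> a)" "\<tau> a \<le> \<tau> b" "\<tau> b \<le> \<tau> j"
    "hi \<le> x (\<tau> a)" "x (\<tau> b) < lo"
    using Suc.prems by auto
  then have le: "a \<le> b" "b \<le> j" using \<tau> by (auto simp: strict_mono_less_eq)
  have "1 \<le> sum ?I {a..<b}"
    by (rule descent_ge_1[OF le(1)])
       (use play_bounds[OF h, of "x \<circ> \<tau>" a] play_bounds[OF h, of "x \<circ> \<tau>" b] ab hi lo in
        \<open>auto simp del: play.simps\<close>)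
  moreover have "of_nat k \<le> sum ?I {..<a}" using Suc.IH ab(1) by blast
  ultimately have "of_nat (Suc k) \<le> sum ?I {..<a} + sum ?I {a..<b}"
    by (subst of_nat_Suc, subst add.commute) (rule add_mono)
  also have "\<dots> = sum ?I {..<b}"
    unfolding lessThan_atLeast0 using le(1) by (intro sum.atLeastLessThan_concat) auto
  also have "\<dots> \<le> sum ?I {..<j}" using le(2) by (intro sum_mono2) auto
  finally show ?case .
qed

section \<open>Sampling a cadlag path on fine grids\<close>

lemma eventually_grid_point:
  assumes "0 \<le> u" "u < v" "v \<le> T"
  shows "\<forall>\<^sub>F n in sequentially. \<exists>i\<le>Suc n. u < real i * T / real (Suc n) \<and> real i * T / real (Suc n) < v"
proof -
  have T: "0 < T" using assms by simp
  have "(\<lambda>n. T / real (Suc n)) \<longlonglongrightarrow> 0"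
    by (rule LIMSEQ_Suc[OF lim_const_over_n])
  then have "\<forall>\<^sub>F n in sequentially. T / real (Suc n) < v - u"
    using assms by (intro order_tendstoD) auto
  then show ?thesis
  proof eventually_elim
    case (elim n)
    \<comment> \<open>The index of the first grid point strictly after \<open>u\<close>, which
      exceeds \<open>u\<close> by at most one mesh width.\<close>
    define i where "i = nat \<lfloor>u * real (Suc n) / T\<rfloor> + 1"
    have nn: "0 \<le> u * real (Suc n) / T" using assms T by simp
    have i: "real i - 1 \<le> u * real (Suc n) / T" "u * real (Suc n) / T < real i"
      using nn by (auto simp: i_def) linarith+
    have 1: "u < real i * T / real (Suc n)" using i(2) T by (simp add: field_simps)
    have "(real i - 1) * T / real (Suc n) \<le> u" using i(1) T by (simp add: field_simps)
    then have 2: "real i * T / real (Suc n) < v" using elim by (simp add: field_simps)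
    then have "real i * T / real (Suc n) < T" using assms by linarith
    then have "real i < real (Suc n)" using T by (simp add: field_simps del: of_nat_Suc)
    then have "i \<le> Suc n" by simp
    then show ?case using 1 2 by blast
  qed
qed

lemma cadlag_uminus: "cadlag x \<Longrightarrow> cadlag (\<lambda>u. - x u)"
  by (fastforce simp: cadlag_def intro: tendsto_minus)

definition grid :: "real \<Rightarrow> nat \<Rightarrow> nat \<Rightarrow> real" where
  "grid T n i = real i * T / real (Suc n)"

text \<open>Right-continuity lets every drop time move slightly to the right onto a fine grid. The
  closed upper barrier is relaxed to \<open>hi'\<close> for this; the open lower one can stay. The
  deadline also needs room on its right, unless it is at least \<open>T\<close>, which is itself a
  grid point.\<close>

lemma drops_grid:
  assumes x: "cadlag x" and hi: "hi' < hi" and lo: "lo \<le> hi"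
  shows "drops {0..} hi lo x k \<tau> \<Longrightarrow> \<tau> \<le> T \<Longrightarrow> \<tau> < \<tau>' \<or> T \<le> \<tau>' \<Longrightarrow>
    \<forall>\<^sub>F n in sequentially. drops (grid T n ` {..Suc n}) hi' lo x k \<tau>'"
proof (induction k arbitrary: \<tau> \<tau>')
  case 0
  then show ?case by simp
next
  case (Suc k)
  obtain a b where ab: "0 \<le> a" "drops {0..} hi lo x k a" "a \<le> b" "b \<le> \<tau>" "hi \<le> x a" "x b < lo"
    using Suc.prems by auto
  have "a \<noteq> b" using ab lo by auto
  then have less: "a < b" using ab by simp
  have right: "(x \<longlongrightarrow> x t) (at_right t)" if "0 \<le> t" for t
    using x that by (simp add: cadlag_def)
  have "\<forall>\<^sub>F u in at_right a. hi' < x u"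
    using order_tendstoD(1)[OF right[OF ab(1)]] hi ab by auto
  then obtain a2 where a2: "a < a2" "\<And>u. a < u \<Longrightarrow> u < a2 \<Longrightarrow> hi' < x u"
    by (auto simp: eventually_at_right_field)
  define m where "m = min a2 b"
  have m: "a < m" "m \<le> b" "m \<le> T" "\<And>u. a < u \<Longrightarrow> u < m \<Longrightarrow> hi' < x u"
    using a2 less ab Suc.prems by (auto simp: m_def)
  \<comment> \<open>Earlier drops may move up to \<open>a1\<close>, and the start of this drop moves
    to a grid point between \<open>a1\<close> and \<open>m\<close>. As \<open>m\<close> is at most
    \<open>b\<close>, the order of the times is preserved.\<close>
  define a1 where "a1 = (a + m) / 2"
  have a1: "a < a1" "a1 < m" using m by (auto simp: a1_def)
  have ev1: "\<forall>\<^sub>F n in sequentially. drops (grid T n ` {..Suc n}) hi' lo x k a1"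
    using Suc.IH[of a a1] ab Suc.prems a1 by auto
  have ev2: "\<forall>\<^sub>F n in sequentially. \<exists>i\<le>Suc n. a1 < grid T n i \<and> grid T n i < m"
    unfolding grid_def using ab a1 m by (intro eventually_grid_point) auto
  have ev3: "\<forall>\<^sub>F n in sequentially. \<exists>i\<le>Suc n. b \<le> grid T n i \<and> grid T n i \<le> \<tau>' \<and> x (grid T n i) < lo"
  proof (cases "b = T")
    case True
    have last: "grid T n (Suc n) = b" for n using True by (simp add: grid_def)
    show ?thesis
    proof (intro always_eventually allI)
      fix n
      show "\<exists>i\<le>Suc n. b \<le> grid T n i \<and> grid T n i \<le> \<tau>' \<and> x (grid T n i) < lo"
        using ab Suc.prems True last[of n] by (intro exI[of _ "Suc n"]) auto
    qed
  next
    case False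
    then have bT: "b < T" "b < \<tau>'" using ab Suc.prems by auto
    have "\<forall>\<^sub>F u in at_right b. x u < lo"
      using order_tendstoD(2)[OF right[of b]] ab by auto
    then obtain b2 where b2: "b < b2" "\<And>u. b < u \<Longrightarrow> u < b2 \<Longrightarrow> x u < lo"
      by (auto simp: eventually_at_right_field)
    have "\<forall>\<^sub>F n in sequentially. \<exists>i\<le>Suc n. b < grid T n i \<and> grid T n i < Min {b2, T, \<tau>'}"
      unfolding grid_def using ab bT b2 by (intro eventually_grid_point) auto
    then show ?thesis
    proof eventually_elim
      case (elim n)
      then obtain i where "i \<le> Suc n" "b < grid T n i" "grid T n i < Min {b2, T, \<tau>'}" by blast
      then show ?case using b2 by (intro exI[of _ i]) auto
    qed
  qed
  from ev1 ev2 ev3 show ?case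
  proof eventually_elim
    case (elim n)
    then obtain i j where ij: "i \<le> Suc n" "a1 < grid T n i" "grid T n i < m"
      "j \<le> Suc n" "b \<le> grid T n j" "grid T n j \<le> \<tau>'" "x (grid T n j) < lo" by blast
    have "hi' < x (grid T n i)" using m(4)[of "grid T n i"] ij a1 by auto
    moreover have "drops (grid T n ` {..Suc n}) hi' lo x k (grid T n i)"
      using drops_mono[OF elim(1)] ij by auto
    ultimately show ?case using ij m
      by (intro drops_SucI[of _ _ _ _ _ "grid T n i" "grid T n j"]) auto
  qed
qed

text \<open>For each level the crossings by \<open>x\<close> are eventually matched by steps of the
  play on the grid. Fatou's lemma bounds the integral by the variation of the play, which
  \<open>play_variation\<close> controls uniformly in the grid.\<close>

lemma integral_ncross_le_truncated_variation:
  assumes x: "cadlag x" and T: "0 \<le> T" and c: "0 < c'" "c' < c"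
    and fin: "truncated_variation c' x 0 T < \<infinity>"
  shows "(\<integral>\<^sup>+y. ncross c x 0 T y \<partial>lborel) \<le> ennreal (real_of_ereal (truncated_variation c' x 0 T) + c')"
proof (cases "T = 0")
  \<comment> \<open>At a single time the range is \<open>{x 0}\<close>, and one level is a null
    set.\<close>
  case True
  have "AE y in lborel. ncross c x 0 T y = 0"
    using AE_lborel_singleton[of "x 0"] True c ncross_eq_0[of c x 0 T "{x 0}"]
    by (auto simp: is_interval_1 elim!: eventually_mono)
  then have "(\<integral>\<^sup>+y. ncross c x 0 T y \<partial>lborel) = 0"
    by (subst nn_integral_0_iff_AE) auto
  then show ?thesis by simp
next
  case False
  with T have T: "0 < T" by simp
  define V where "V u = real_of_ereal (truncated_variation c' x 0 u)" for u
  have V: "truncated_variation c' x 0 u = ereal (V u)" if "0 \<le> u" "u \<le> T" for u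
    unfolding V_def using truncated_variation_real[of c' 0 u T x] that fin c by auto
  have Vi: "V u + excess c' x u v \<le> V v" if "0 \<le> u" "u \<le> v" "v \<le> T" for u v
    using truncated_variation_add_excess[of c' 0 u v x] V[of u] V[of v] that c by simp
  have V0: "0 \<le> V 0" using V[of 0] truncated_variation_nonneg[of 0 0 c' x] T by simp
  define h where "h = c' / 2"
  have h: "0 \<le> h" using c by (simp add: h_def)
  have mono: "strict_mono (grid T n)" for n
    using T by (auto simp: grid_def strict_mono_def divide_strict_right_mono)
  define p where "p n = play h (x \<circ> grid T n)" for n
  define D where "D n y = (\<Sum>i<Suc n. indicator {p n (Suc i)..<p n i} y :: ennreal)" for n y
  define E where "E n y = (\<Sum>i<Suc n. indicator {p n i<..p n (Suc i)} y :: ennreal)" for n y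
  have E: "E n y = (\<Sum>i<Suc n. indicator {- p n (Suc i)..<- p n i} (- y))" for n y
    unfolding E_def by (intro sum.cong) (auto split: split_indicator)
  have pm: "play h ((\<lambda>u. - x u) \<circ> grid T n) i = - p n i" for n i
    using play_uminus[OF h, of "x \<circ> grid T n" i] by (simp add: p_def comp_def)
  note x' = cadlag_uminus[OF x]
  have down: "\<forall>\<^sub>F n in sequentially. of_nat k \<le> D n y"
    \<comment> \<open>The relaxed barrier \<open>y + (c + c')/4\<close> is the midpoint of
      \<open>y + c'/2\<close> and \<open>y + c/2\<close>: strictly below the barrier of the path and
      strictly above what the play needs.\<close>
    if "drops {0..} (y + c/2) (y - c/2) x k T" for k y
  proof -
    have "\<forall>\<^sub>F n in sequentially. drops (grid T n ` {..Suc n}) (y + (c + c')/4) (y - c/2) x k T"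
      using c by (intro drops_grid[OF x _ _ that]) auto
    then show ?thesis
    proof eventually_elim
      case (elim n)
      then have "drops (grid T n ` {..Suc n}) (y + (c + c')/4) (y - c/2) x k (grid T n (Suc n))"
        by (simp add: grid_def)
      from drops_le_play_descents[OF h mono _ _ this, of y] c
      show ?case by (simp add: D_def p_def h_def)
    qed
  qed
  have up: "\<forall>\<^sub>F n in sequentially. of_nat k \<le> E n y"
    if "drops {0..} (- y + c/2) (- y - c/2) (\<lambda>u. - x u) k T" for k y
  proof -
    have "\<forall>\<^sub>F n in sequentially. drops (grid T n ` {..Suc n}) (- y + (c + c')/4) (- y - c/2) (\<lambda>u. - x u) k T"
      using c by (intro drops_grid[OF x' _ _ that]) auto
    then show ?thesis
    proof eventually_elim
      case (elim n)
      then have "drops (grid T n ` {..Suc n}) (- y + (c + c')/4) (- y - c/2) (\<lambda>u. - x u) k (grid T n (Suc n))"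
        by (simp add: grid_def)
      from drops_le_play_descents[OF h mono _ _ this, of "- y"] c
      show ?case unfolding E pm by (simp add: h_def)
    qed
  qed
  have "ncross c x 0 T y \<le> liminf (\<lambda>n. E n y + D n y)" for y
    unfolding ncross_def ndrops_def
  proof (rule SUP_add_SUP_le)
    fix k l assume "k \<in> {k. drops {0..} (- y + c/2) (- y - c/2) (\<lambda>u. - x u) k T}"
      "l \<in> {k. drops {0..} (y + c/2) (y - c/2) x k T}"
    then have "\<forall>\<^sub>F n in sequentially. of_nat k \<le> E n y" "\<forall>\<^sub>F n in sequentially. of_nat l \<le> D n y"
      using up down by auto
    then have "\<forall>\<^sub>F n in sequentially. of_nat k + of_nat l \<le> E n y + D n y"
      by eventually_elim (rule add_mono)
    then show "of_nat k + of_nat l \<le> liminf (\<lambda>n. E n y + D n y)" by (rule Liminf_bounded)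
  qed (auto intro: exI[of _ 0])
  then have "(\<integral>\<^sup>+y. ncross c x 0 T y \<partial>lborel) \<le> (\<integral>\<^sup>+y. liminf (\<lambda>n. E n y + D n y) \<partial>lborel)"
    by (rule nn_integral_mono)
  also have "\<dots> \<le> liminf (\<lambda>n. \<integral>\<^sup>+y. E n y + D n y \<partial>lborel)"
    by (rule nn_integral_liminf) (simp add: D_def E_def)
  also have "\<dots> \<le> liminf (\<lambda>n::nat. ennreal (V T + c'))"
  proof (intro Liminf_mono always_eventually allI)
    fix n
    have len: "emeasure lborel {a<..b} = ennreal (b - a)" "emeasure lborel {a..<b} = ennreal (b - a)"
      for a b :: real
      by (cases "a \<le> b"; simp add: ennreal_neg)+
    \<comment> \<open>Since \<open>ennreal\<close> cuts negative numbers off at 0, the upward and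
      downward lengths of a step add up to its absolute size.\<close>
    have int: "ennreal (a - b) + ennreal (b - a) = ennreal \<bar>a - b\<bar>" for a b :: real
      by (cases "a \<le> b") (simp_all add: ennreal_neg)
    have "(\<integral>\<^sup>+y. E n y + D n y \<partial>lborel) =
        (\<Sum>i<Suc n. ennreal (p n (Suc i) - p n i)) + (\<Sum>i<Suc n. ennreal (p n i - p n (Suc i)))"
      unfolding D_def E_def
      by (simp add: nn_integral_add nn_integral_sum len del: sum.lessThan_Suc)
    also have "\<dots> = (\<Sum>i<Suc n. ennreal \<bar>p n (Suc i) - p n i\<bar>)"
      by (subst sum.distrib[symmetric]) (simp add: int del: sum.lessThan_Suc)
    also have "\<dots> = ennreal (\<Sum>i<Suc n. \<bar>p n (Suc i) - p n i\<bar>)"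
      by (rule sum_ennreal) simp
    also have "(\<Sum>i<Suc n. \<bar>p n (Suc i) - p n i\<bar>) \<le> V (grid T n (Suc n)) + 2 * h"
      unfolding p_def
    proof (rule play_variation[where W = "\<lambda>i. V (grid T n i)"])
      show "0 \<le> V (grid T n 0)" using V0 by (simp add: grid_def)
    next
      fix i j assume ij: "i \<le> j" "j \<le> Suc n"
      have "grid T n i \<le> grid T n j" using mono[of n] ij by (simp add: strict_mono_less_eq)
      moreover have "grid T n j \<le> grid T n (Suc n)" using mono[of n] ij by (simp add: strict_mono_less_eq)
      moreover have "0 \<le> grid T n i" "grid T n (Suc n) = T" using T by (simp_all add: grid_def)
      ultimately show "V (grid T n i) + max (\<bar>(x \<circ> grid T n) j - (x \<circ> grid T n) i\<bar> - 2 * h) 0 \<le> V (grid T n j)"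
        using Vi[of "grid T n i" "grid T n j"] by (simp add: excess_def h_def)
    qed (rule h)
    finally show "(\<integral>\<^sup>+y. E n y + D n y \<partial>lborel) \<le> ennreal (V T + c')"
      by (simp add: h_def grid_def ennreal_leI)
  qed
  also have "\<dots> = ennreal (V T + c')" by (rule Liminf_const) simp
  finally show ?thesis by (simp add: V_def)
qed

section \<open>Crossing times\<close>

lemma Inf_ereal_image_approach:
  assumes "Inf (ereal ` A) = ereal r" "0 < e"
  obtains a where "a \<in> A" "r \<le> a" "a < r + e"
proof -
  have "Inf (ereal ` A) < ereal (r + e)" using assms by simp
  then obtain a where a: "a \<in> A" "a < r + e" by (auto simp: Inf_less_iff)
  moreover have "ereal r \<le> ereal a" using a assms(1) by (metis Inf_lower imageI)
  ultimately show ?thesis using that by simp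
qed

lemma downcrossing_time_ge:
  "ereal s \<le> downcrossing_time y c x s t n"
proof (induction n)
  case (Suc n)
  also have "downcrossing_time y c x s t n \<le> entry_above y c x t (downcrossing_time y c x s t n)"
    unfolding entry_above_def by (rule Inf_greatest) auto
  also have "\<dots> \<le> downcrossing_time y c x s t (Suc n)"
    by (simp add: entry_below_def) (rule Inf_greatest, auto)
  finally show ?case .
qed simp

text \<open>First-entry times are optimal: by induction they come no later than the times of any
  other run of drops.\<close>

lemma downcrossing_time_le_if_drops:
  assumes "drops {s..} (y + c/2) (y - c/2) x n \<tau>" "s \<le> \<tau>" "\<tau> \<le> t"
  shows "downcrossing_time y c x s t n \<le> ereal \<tau>"
  using assms
proof (induction n arbitrary: \<tau>)
  case (Suc n)
  then obtain a b where ab: "s \<le> a" "drops {s..} (y + c/2) (y - c/2) x n a" "a \<le> b" "b \<le> \<tau>"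
    "y + c/2 \<le> x a" "x b < y - c/2" by auto
  have "downcrossing_time y c x s t n \<le> ereal a" using Suc.IH[of a] Suc.prems ab by auto
  then have "entry_above y c x t (downcrossing_time y c x s t n) \<le> ereal a"
    unfolding entry_above_def using ab Suc.prems by (intro Inf_lower) auto
  also have "\<dots> \<le> ereal b" using ab by simp
  finally have "downcrossing_time y c x s t (Suc n) \<le> ereal b"
    using ab Suc.prems by (auto simp: entry_below_def intro!: Inf_lower)
  also have "\<dots> \<le> ereal \<tau>" using ab by simp
  finally show ?case .
qed simp

text \<open>The upper barrier is closed, so right-continuity makes the infimum an actual entry time.
  For the open lower barrier this can fail.\<close>

lemma entry_above_attained:
  assumes x: "cadlag x" and s: "0 \<le> s" "ereal s \<le> a" and fin: "entry_above y c x t a \<le> ereal u"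
  obtains r where "entry_above y c x t a = ereal r" "a \<le> ereal r" "y + c/2 \<le> x r"
proof -
  let ?A = "{u. a \<le> ereal u \<and> u \<le> t \<and> x u \<ge> y + c / 2}"
  have low: "a \<le> entry_above y c x t a"
    unfolding entry_above_def by (rule Inf_greatest) auto
  with s fin obtain r where r: "entry_above y c x t a = ereal r" "s \<le> r"
    by (cases "entry_above y c x t a") (auto dest: order_trans)
  have "y + c/2 \<le> x r"
  proof (rule ccontr)
    assume "\<not> y + c/2 \<le> x r"
    then have "\<forall>\<^sub>F u in at_right r. x u < y + c/2"
      using order_tendstoD(2)[of x "x r" "at_right r" "y + c/2"] x s r by (auto simp: cadlag_def)
    then obtain b where b: "r < b" "\<And>u. r < u \<Longrightarrow> u < b \<Longrightarrow> x u < y + c/2"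
      by (auto simp: eventually_at_right_field)
    obtain v where "v \<in> ?A" "r \<le> v" "v < r + (b - r)"
      using Inf_ereal_image_approach[of ?A r "b - r"] r b by (auto simp: entry_above_def)
    then show False using b(2)[of v] \<open>\<not> y + c/2 \<le> x r\<close> by (cases "v = r") auto
  qed
  then show ?thesis using that r low by simp
qed

text \<open>Entry below the open barrier may occur only after the infimum, so \<open>n\<close> drops
  are guaranteed at times strictly after the \<open>n\<close>-th downcrossing time. At the horizon
  \<open>t\<close> equality is allowed: for \<open>n > 0\<close> a finite infimum means that some
  entry happened by time \<open>t\<close>.\<close>

lemma drops_if_downcrossing_time:
  assumes x: "cadlag x" and s: "0 \<le> s" and c: "0 < c"
  shows "downcrossing_time y c x s t n \<le> ereal t \<Longrightarrow> drops {s..} (y + c/2) (y - c/2) x n t"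
    and "\<tau> \<le> t \<Longrightarrow> downcrossing_time y c x s t n < ereal \<tau> \<Longrightarrow> drops {s..} (y + c/2) (y - c/2) x n \<tau>"
proof -
  let ?d = "downcrossing_time y c x s t"
  let ?R = "drops {s..} (y + c/2) (y - c/2) x"
  have step: "?R (Suc n) \<tau>"
    if IH: "\<And>\<tau>. \<tau> \<le> t \<Longrightarrow> ?d n < ereal \<tau> \<Longrightarrow> ?R n \<tau>"
      and u: "entry_above y c x t (?d n) \<le> ereal u" "u \<le> \<tau>" "\<tau> \<le> t" "x u < y - c/2" for n u \<tau>
  proof -
    obtain r where r: "entry_above y c x t (?d n) = ereal r" "?d n \<le> ereal r" "y + c/2 \<le> x r"
      using entry_above_attained[OF x s downcrossing_time_ge u(1)] by blast
    have ru: "r \<le> u" using r u by simp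
    have sr: "s \<le> r" using downcrossing_time_ge[of s y c x t n] r(2) by (metis ereal_less_eq(3) order_trans)
    have "?R n r"
    proof (cases "?d n = ereal r")
      case False
      then show ?thesis using IH[of r] r ru u by auto
    next
      \<comment> \<open>For \<open>n = Suc m\<close>, values below \<open>y - c/2\<close> would
        occur at \<open>r\<close> or arbitrarily soon after it, contradicting
        \<open>y + c/2 \<le> x r\<close> and right-continuity. Only \<open>n = 0\<close>
        remains.\<close>
      case True
      show ?thesis
      proof (cases n)
        case (Suc m)
        have "y - c/2 < x r" using r c by simp
        then have "\<forall>\<^sub>F u in at_right r. y - c/2 < x u"
          using order_tendstoD(1)[of x "x r" "at_right r" "y - c/2"] x s sr by (auto simp: cadlag_def)
        then obtain b where b: "r < b" "\<And>u. r < u \<Longrightarrow> u < b \<Longrightarrow> y - c/2 < x u"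
          by (auto simp: eventually_at_right_field)
        obtain v where "x v < y - c/2" "r \<le> v" "v < r + (b - r)"
          using Inf_ereal_image_approach[of "{u. entry_above y c x t (?d m) \<le> ereal u \<and> u \<le> t \<and> x u < y - c / 2}" r "b - r"]
            True b Suc by (auto simp: entry_below_def)
        then show ?thesis using b(2)[of v] \<open>y - c/2 < x r\<close> by (cases "v = r") auto
      qed simp
    qed
    then show ?thesis using r ru sr u by (intro drops_SucI[of _ _ _ _ _ r u]) auto
  qed
  have strict: "?R n \<tau>" if "\<tau> \<le> t" "?d n < ereal \<tau>" for n \<tau>
    using that
  proof (induction n arbitrary: \<tau>)
    case (Suc n)
    from Suc.prems(2) obtain u where "entry_above y c x t (?d n) \<le> ereal u" "u < \<tau>" "x u < y - c/2"
      by (auto simp: entry_below_def Inf_less_iff)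
    then show ?case using step[of n u \<tau>] Suc by auto
  qed simp
  then show "\<tau> \<le> t \<Longrightarrow> ?d n < ereal \<tau> \<Longrightarrow> ?R n \<tau>" .
  show "?R n t" if "?d n \<le> ereal t"
  proof (cases n)
    case (Suc m)
    have "{u. entry_above y c x t (?d m) \<le> ereal u \<and> u \<le> t \<and> x u < y - c / 2} \<noteq> {}"
    proof
      assume "{u. entry_above y c x t (?d m) \<le> ereal u \<and> u \<le> t \<and> x u < y - c / 2} = {}"
      then have "?d n = Inf (ereal ` {})"
        unfolding Suc downcrossing_time.simps entry_below_def by (simp only:)
      then have "?d n = \<infinity>" by (simp add: top_ereal_def)
      then show False using that by simp
    qed
    then show ?thesis using step[of m _ t] strict[of _ m] Suc by auto
  qed simp
qed

text \<open>Each drop through a band of width \<open>c\<close> spends at least \<open>c - c'\<close>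
  of the truncated variation at threshold \<open>c'\<close>. This makes the number of drops
  finite.\<close>

lemma drops_bounded:
  assumes c: "0 < c'" "c' < c" and fin: "truncated_variation c' x 0 T < \<infinity>"
  shows "drops {0..} (y + c/2) (y - c/2) x k \<tau> \<Longrightarrow> 0 \<le> \<tau> \<Longrightarrow> \<tau> \<le> T \<Longrightarrow>
    ereal (real k * (c - c')) \<le> truncated_variation c' x 0 \<tau>"
proof (induction k arbitrary: \<tau>)
  case 0
  then show ?case using truncated_variation_nonneg[of 0 \<tau> c' x] by (simp add: zero_ereal_def)
next
  case (Suc k)
  then obtain a b where ab: "0 \<le> a" "drops {0..} (y + c/2) (y - c/2) x k a" "a \<le> b" "b \<le> \<tau>"
    "y + c/2 \<le> x a" "x b < y - c/2" by auto
  have "c - c' \<le> excess c' x a b" using ab by (simp add: excess_def)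
  then have "ereal (real (Suc k) * (c - c')) \<le> ereal (real k * (c - c')) + ereal (excess c' x a b)"
    by (simp add: algebra_simps)
  also have "\<dots> \<le> truncated_variation c' x 0 a + ereal (excess c' x a b)"
    using Suc.IH[of a] ab Suc.prems by (intro add_right_mono) auto
  also have "\<dots> \<le> truncated_variation c' x 0 b"
    using ab c by (intro truncated_variation_add_excess) auto
  also have "\<dots> \<le> truncated_variation c' x 0 \<tau>"
    using ab c by (intro truncated_variation_mono) auto
  finally show ?case .
qed

text \<open>The stopping-time count and \<open>ndrops\<close> range over the same set of naturals.
  By \<open>drops_bounded\<close> it is finite, so its maximum is its supremum.\<close>

lemma ennreal_downcrossings:
  assumes x: "cadlag x" and T: "0 \<le> T" and c: "0 < c'" "c' < c"
    and fin: "truncated_variation c' x 0 T < \<infinity>"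
  shows "of_nat (downcrossings y c x 0 T) = ndrops c x 0 T y"
proof -
  let ?A = "{k. drops {0..} (y + c/2) (y - c/2) x k T}"
  have eq: "{n. downcrossing_time y c x 0 T n \<le> ereal T} = ?A"
    using drops_if_downcrossing_time(1)[OF x, of 0 c y T] downcrossing_time_le_if_drops[of 0 y c x _ T T] c T
    by auto
  obtain v where v: "truncated_variation c' x 0 T = ereal v"
    using truncated_variation_real[of c' 0 T T x] fin T c by auto
  have "?A \<subseteq> {..nat \<lceil>v / (c - c')\<rceil>}"
  proof
    fix k assume "k \<in> ?A"
    then have "ereal (real k * (c - c')) \<le> ereal v"
      using drops_bounded[OF c fin, of y k T] T v by simp
    then have "real k \<le> v / (c - c')" using c by (simp add: field_simps)
    then show "k \<in> {..nat \<lceil>v / (c - c')\<rceil>}" by (simp add: le_nat_iff) linarith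
  qed
  then have fin: "finite ?A" by (rule finite_subset) simp
  have ne: "?A \<noteq> {}" by (auto intro: exI[of _ 0])
  have "ndrops c x 0 T y = of_nat (Max ?A)"
    unfolding ndrops_def
  proof (rule antisym)
    show "(SUP k\<in>?A. of_nat k) \<le> (of_nat (Max ?A) :: ennreal)"
      by (rule SUP_least) (use fin in \<open>simp add: Max_ge del: mem_Collect_eq\<close>)
    show "(of_nat (Max ?A) :: ennreal) \<le> (SUP k\<in>?A. of_nat k)"
      by (rule SUP_upper) (rule Max_in[OF fin ne])
  qed
  then show ?thesis by (simp add: downcrossings_def eq)
qed

lemma truncated_variation_uminus:
  "truncated_variation c (\<lambda>u. - x u) s t = truncated_variation c x s t"
proof -
  have "\<bar>- a - - b\<bar> = \<bar>a - b\<bar>" for a b :: real by simp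
  then show ?thesis unfolding truncated_variation_def by presburger
qed

lemma ennreal_crossings:
  assumes "cadlag x" "0 \<le> T" "0 < c'" "c' < c" "truncated_variation c' x 0 T < \<infinity>"
  shows "of_nat (crossings y c x 0 T) = ncross c x 0 T y"
  using ennreal_downcrossings[OF assms, of y]
    ennreal_downcrossings[OF cadlag_uminus[OF assms(1)] assms(2-4), of "- y"] assms(5)
  by (simp add: crossings_def upcrossings_def ncross_def truncated_variation_uminus)

section \<open>Measurability and time integrals of a cadlag path\<close>

lemma cadlag_measurable:
  assumes x: "cadlag x"
  shows "(\<lambda>s. x (max 0 s)) \<in> borel_measurable borel"
proof (rule borel_measurable_LIMSEQ_real)
  fix s :: real
  \<comment> \<open>These points depend on \<open>s\<close> only through an integer and approach
    \<open>max 0 s\<close> strictly from the right, where the path is right-continuous.\<close>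
  let ?u = "\<lambda>n s. (real (nat \<lfloor>real (Suc n) * max 0 s\<rfloor>) + 1) / real (Suc n)"
  have bounds: "max 0 s < ?u n s \<and> ?u n s \<le> max 0 s + 1 / real (Suc n)" for n
  proof -
    have gen: "m < (k + 1) / S \<and> (k + 1) / S \<le> m + 1 / S" if "0 < S" "k \<le> S * m" "S * m < k + 1"
      for k m S :: real
      using that by (simp add: field_simps)
    have "0 \<le> real (Suc n) * max 0 s" by simp
    then have "real (nat \<lfloor>real (Suc n) * max 0 s\<rfloor>) \<le> real (Suc n) * max 0 s"
      "real (Suc n) * max 0 s < real (nat \<lfloor>real (Suc n) * max 0 s\<rfloor>) + 1"
      by linarith+
    then show ?thesis by (intro gen) auto
  qed
  have "(\<lambda>n. ?u n s) \<longlonglongrightarrow> max 0 s"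
  proof (rule tendsto_sandwich[of "\<lambda>_. max 0 s" _ _ "\<lambda>n. max 0 s + 1 / real (Suc n)"])
    show "(\<lambda>n. max 0 s + 1 / real (Suc n)) \<longlonglongrightarrow> max 0 s"
      using tendsto_add[OF tendsto_const LIMSEQ_Suc[OF lim_const_over_n[of 1]], of "max 0 s"] by simp
  qed (use bounds in \<open>auto intro!: always_eventually less_imp_le\<close>)
  then have "filterlim (\<lambda>n. ?u n s) (at_right (max 0 s)) sequentially"
    unfolding filterlim_at
    by (intro conjI always_eventually allI) (use bounds in \<open>metis greaterThan_iff less_irrefl\<close>)+
  moreover have "(x \<longlongrightarrow> x (max 0 s)) (at_right (max 0 s))"
    using x by (simp add: cadlag_def)
  ultimately show "(\<lambda>n. x (?u n s)) \<longlonglongrightarrow> x (max 0 s)" by (rule filterlim_compose[rotated])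
next
  fix n
  have "(\<lambda>s. nat \<lfloor>real (Suc n) * max 0 s\<rfloor>) \<in> borel \<rightarrow>\<^sub>M count_space UNIV" by measurable
  then show "(\<lambda>s. x ((real (nat \<lfloor>real (Suc n) * max 0 s\<rfloor>) + 1) / real (Suc n))) \<in> borel_measurable borel"
    by (rule measurable_compose[where g = "\<lambda>k. x ((real k + 1) / real (Suc n))"]) simp
qed

text \<open>The Lebesgue form is needed for the occupation measure, the gauge integral for joining
  adjacent intervals. Using \<open>max 0 s\<close> gives a function measurable on the whole line and
  changes nothing on \<open>{a..b}\<close>.\<close>

lemma integrable_comp:
  fixes f :: "real \<Rightarrow> real"
  assumes x: "cadlag x" and f: "f \<in> borel_measurable borel" "\<And>y. \<bar>f y\<bar> \<le> B" and a: "0 \<le> a"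
  shows "set_integrable lborel {a..b} (\<lambda>s. f (x (max 0 s)))"
    and "(\<lambda>s. f (x s)) integrable_on {a..b}"
    and "(LINT s:{a..b}|lborel. f (x (max 0 s))) = integral {a..b} (\<lambda>s. f (x s))"
proof -
  have [measurable]: "(\<lambda>s. f (x (max 0 s))) \<in> borel_measurable borel"
    using measurable_compose[OF cadlag_measurable[OF x] f(1)] .
  show int: "set_integrable lborel {a..b} (\<lambda>s. f (x (max 0 s)))"
    unfolding set_integrable_def
  proof (rule Bochner_Integration.integrable_bound[of lborel "\<lambda>s. B * indicator {a..b} s"])
    show "integrable lborel (\<lambda>s. B * indicator {a..b} s)"
      by (intro integrable_mult_right integrable_real_indicator) (auto simp: emeasure_lborel_Icc_eq)
    show "AE s in lborel. norm (indicat_real {a..b} s *\<^sub>R f (x (max 0 s))) \<le> norm (B * indicator {a..b} s)"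
      using f(2) by (auto split: split_indicator intro!: AE_I2 order_trans[OF f(2)])
  qed simp
  have eq: "f (x (max 0 s)) = f (x s)" if "s \<in> {a..b}" for s using that a by simp
  show "(\<lambda>s. f (x s)) integrable_on {a..b}"
    by (rule integrable_eq[OF set_borel_integral_eq_integral(1)[OF int]]) (use eq in auto)
  show "(LINT s:{a..b}|lborel. f (x (max 0 s))) = integral {a..b} (\<lambda>s. f (x s))"
    unfolding set_borel_integral_eq_integral(2)[OF int]
    by (rule Henstock_Kurzweil_Integration.integral_cong) (use eq in auto)
qed

section \<open>Asymptotics along a path\<close>

text \<open>A single path with the limit at all times. The exponent \<gamma> stands for
  \<open>1 / \<beta> - 1\<close>, so \<open>-1 < \<gamma>\<close> expresses that \<beta> is
  positive.\<close>

locale tv_limit =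
  fixes x :: "real \<Rightarrow> real" and \<gamma> C :: real
  assumes cadlag: "cadlag x" and \<gamma>: "-1 < \<gamma>" and C: "0 \<le> C"
    and TV: "\<And>t. 0 \<le> t \<Longrightarrow>
      ((\<lambda>c. ereal (c powr \<gamma>) * truncated_variation c x 0 t) \<longlongrightarrow> ereal (C * t)) (at_right 0)"
begin

lemma tv_finite:
  assumes "0 \<le> t"
  shows "\<forall>\<^sub>F c in at_right 0. truncated_variation c x 0 t < \<infinity>"
proof -
  have "\<forall>\<^sub>F c in at_right 0. ereal (c powr \<gamma>) * truncated_variation c x 0 t < \<infinity>"
    using order_tendstoD(2)[OF TV[OF assms], of \<infinity>] by simp
  with eventually_at_right_less[of 0] show ?thesis
    by eventually_elim (auto simp: less_top[symmetric] top_ereal_def)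
qed

definition tv :: "real \<Rightarrow> real \<Rightarrow> real" where
  "tv c t = real_of_ereal (truncated_variation c x 0 t)"

lemma tv_tendsto: "0 \<le> t \<Longrightarrow> ((\<lambda>c. c powr \<gamma> * tv c t) \<longlongrightarrow> C * t) (at_right 0)"
  using lim_real_of_ereal[OF TV[of t]] by (simp add: tv_def comp_def)

text \<open>This makes two additive errors negligible: the \<open>c\<close> lost in
  \<open>truncated_variation_split\<close> and the \<open>c'\<close> gained in
  \<open>integral_ncross_le_truncated_variation\<close>.\<close>

lemma powr_tendsto_0: "((\<lambda>c. c powr \<gamma> * c) \<longlongrightarrow> 0) (at_right 0)"
proof -
  have "((\<lambda>c. c powr (\<gamma> + 1)) \<longlongrightarrow> 0) (at_right 0)"
    using \<gamma> by (intro tendsto_eq_intros refl filterlim_ident | auto simp: eventually_at_right_less less_imp_le intro!: eventually_at_rightI[of 0 1])+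
  moreover have "\<forall>\<^sub>F c in at_right 0. c powr (\<gamma> + 1) = c powr \<gamma> * c"
    using eventually_at_right_less[of 0] by eventually_elim (simp add: powr_add)
  ultimately show ?thesis by (rule Lim_transform_eventually)
qed

text \<open>The play estimate is applied with \<open>c' = q * c\<close>. Changing the scale from
  \<open>c\<close> to \<open>q * c\<close> costs the factor \<open>q powr (- \<gamma>)\<close>,
  which is close to 1 for \<open>q\<close> close to 1.\<close>

lemma mass_upper:
  assumes t: "0 \<le> t" and \<delta>: "0 < \<delta>"
  shows "\<forall>\<^sub>F c in at_right 0.
    ennreal (c powr \<gamma>) * (\<integral>\<^sup>+y. ncross c x 0 t y \<partial>lborel) \<le> ennreal (C * t + \<delta>)"
proof -
  have "((\<lambda>q. q powr (- \<gamma>) * (C * t)) \<longlongrightarrow> 1 powr (- \<gamma>) * (C * t)) (at_left (1::real))"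
    by (intro tendsto_intros) auto
  then have "\<forall>\<^sub>F q in at_left 1. q powr (- \<gamma>) * (C * t) < C * t + \<delta>"
    using \<delta> by (intro order_tendstoD) auto
  moreover have "\<forall>\<^sub>F q in at_left (1::real). 0 < q \<and> q < 1"
    by (rule eventually_at_leftI[of 0]) auto
  ultimately have "\<forall>\<^sub>F q in at_left 1. q powr (- \<gamma>) * (C * t) < C * t + \<delta> \<and> 0 < q \<and> q < 1"
    by (rule eventually_conj)
  then have "\<exists>q. q powr (- \<gamma>) * (C * t) < C * t + \<delta> \<and> 0 < q \<and> q < 1"
    by (rule eventually_happens'[OF trivial_limit_at_left_real])
  then obtain q where q: "q powr (- \<gamma>) * (C * t) < C * t + \<delta>" "0 < q" "q < 1" by blast
  have lim: "filterlim (\<lambda>c. q * c) (at_right 0) (at_right 0)"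
  proof -
    have "((\<lambda>c. q * c) \<longlongrightarrow> q * 0) (at_right 0)" by (intro tendsto_intros)
    moreover have "\<forall>\<^sub>F c in at_right 0. q * c \<in> {0<..} \<and> q * c \<noteq> 0"
      using eventually_at_right_less[of 0] by eventually_elim (use q in auto)
    ultimately show ?thesis by (simp add: filterlim_at)
  qed
  have "((\<lambda>c. q powr (- \<gamma>) * ((q * c) powr \<gamma> * tv (q * c) t) + q powr (- \<gamma>) * ((q * c) powr \<gamma> * (q * c)))
      \<longlongrightarrow> q powr (- \<gamma>) * (C * t) + q powr (- \<gamma>) * 0) (at_right 0)"
    by (intro tendsto_intros filterlim_compose[OF tv_tendsto lim] filterlim_compose[OF powr_tendsto_0 lim] t)
  then have "\<forall>\<^sub>F c in at_right 0.
      q powr (- \<gamma>) * ((q * c) powr \<gamma> * tv (q * c) t) + q powr (- \<gamma>) * ((q * c) powr \<gamma> * (q * c)) < C * t + \<delta>"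
    using q(1) by (intro order_tendstoD) auto
  with eventually_at_right_less[of 0] eventually_compose_filterlim[OF tv_finite[OF t] lim]
  show ?thesis
  proof eventually_elim
    case (elim c)
    have "(\<integral>\<^sup>+y. ncross c x 0 t y \<partial>lborel) \<le> ennreal (tv (q * c) t + q * c)"
      unfolding tv_def using elim q t by (intro integral_ncross_le_truncated_variation cadlag) auto
    then have "ennreal (c powr \<gamma>) * (\<integral>\<^sup>+y. ncross c x 0 t y \<partial>lborel) \<le> ennreal (c powr \<gamma>) * ennreal (tv (q * c) t + q * c)"
      by (rule mult_left_mono) simp
    also have "\<dots> = ennreal (c powr \<gamma> * (tv (q * c) t + q * c))" by (simp add: ennreal_mult')
    also have "\<dots> \<le> ennreal (C * t + \<delta>)"
    proof (rule ennreal_leI)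
      have "c powr \<gamma> = q powr (- \<gamma>) * (q * c) powr \<gamma>"
        using q elim by (simp add: powr_mult powr_minus field_simps)
      then show "c powr \<gamma> * (tv (q * c) t + q * c) \<le> C * t + \<delta>"
        using elim by (simp add: algebra_simps)
    qed
    finally show ?case .
  qed
qed

text \<open>The crossing integral dominates the truncated variation over \<open>{a..b}\<close>,
  which is at least \<open>tv c b - tv c a - c\<close>; normalised, this tends to
  \<open>C * (b - a)\<close>.\<close>

lemma mass_lower:
  assumes ab: "0 \<le> a" "a \<le> b" and \<delta>: "0 < \<delta>"
  shows "\<forall>\<^sub>F c in at_right 0.
    ennreal (C * (b - a) - \<delta>) \<le> ennreal (c powr \<gamma>) * (\<integral>\<^sup>+y. ncross c x a b y \<partial>lborel)"
proof -
  have "((\<lambda>c. c powr \<gamma> * tv c b - c powr \<gamma> * tv c a - c powr \<gamma> * c) \<longlongrightarrow> C * b - C * a - 0) (at_right 0)"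
    using ab by (intro tendsto_intros tv_tendsto powr_tendsto_0) auto
  then have "\<forall>\<^sub>F c in at_right 0. C * (b - a) - \<delta> < c powr \<gamma> * tv c b - c powr \<gamma> * tv c a - c powr \<gamma> * c"
    using \<delta> by (intro order_tendstoD) (auto simp: algebra_simps)
  moreover have "\<forall>\<^sub>F c in at_right 0. truncated_variation c x 0 b < \<infinity>" using ab by (intro tv_finite) auto
  ultimately show ?thesis
    using eventually_at_right_less[of 0]
  proof eventually_elim
    case (elim c)
    have fin: "truncated_variation c x 0 a = ereal (tv c a)" "truncated_variation c x 0 b = ereal (tv c b)"
      unfolding tv_def using truncated_variation_real[of c 0 _ b x] elim ab by auto
    have "ereal (tv c b) \<le> ereal (tv c a) + truncated_variation c x a b + ereal c"
      using truncated_variation_split[of c 0 a b x] fin elim ab by simp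
    also have "truncated_variation c x a b \<le> enn2ereal (\<integral>\<^sup>+y. ncross c x a b y \<partial>lborel)"
      by (rule truncated_variation_le_integral_ncross[OF ab(2)])
    finally have *: "ereal (tv c b) \<le> ereal (tv c a) + enn2ereal (\<integral>\<^sup>+y. ncross c x a b y \<partial>lborel) + ereal c"
      by (simp add: add_left_mono add_right_mono)
    have N: "ennreal (tv c b - tv c a - c) \<le> (\<integral>\<^sup>+y. ncross c x a b y \<partial>lborel)"
    proof (cases "\<integral>\<^sup>+y. ncross c x a b y \<partial>lborel")
      case (real r)
      then show ?thesis using * by (simp add: ennreal_leI)
    qed simp
    have "ennreal (C * (b - a) - \<delta>) \<le> ennreal (c powr \<gamma> * (tv c b - tv c a - c))"
      using elim by (intro ennreal_leI) (simp add: algebra_simps)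
    also have "\<dots> = ennreal (c powr \<gamma>) * ennreal (tv c b - tv c a - c)" by (simp add: ennreal_mult')
    also have "\<dots> \<le> ennreal (c powr \<gamma>) * (\<integral>\<^sup>+y. ncross c x a b y \<partial>lborel)"
      using N by (rule mult_left_mono) simp
    finally show ?case .
  qed
qed

end

section \<open>Lower bounds for crossing integrals with a nonnegative weight\<close>

context tv_limit begin

definition weighted_mass :: "(real \<Rightarrow> real) \<Rightarrow> real \<Rightarrow> real \<Rightarrow> real \<Rightarrow> ennreal" where
  "weighted_mass f c a b = ennreal (c powr \<gamma>) * (\<integral>\<^sup>+y. ennreal (f y) * ncross c x a b y \<partial>lborel)"

lemma weighted_mass_superadd:
  assumes [measurable]: "f \<in> borel_measurable borel" and ab: "a \<le> b" "b \<le> d"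
  shows "weighted_mass f c a b + weighted_mass f c b d \<le> weighted_mass f c a d"
proof -
  have "weighted_mass f c a b + weighted_mass f c b d = ennreal (c powr \<gamma>) *
      (\<integral>\<^sup>+y. ennreal (f y) * ncross c x a b y + ennreal (f y) * ncross c x b d y \<partial>lborel)"
    unfolding weighted_mass_def by (subst nn_integral_add) (auto simp: distrib_left)
  also have "\<dots> \<le> weighted_mass f c a d"
    unfolding weighted_mass_def using ab
    by (intro mult_left_mono nn_integral_mono) (auto simp: distrib_left[symmetric] intro!: mult_left_mono ncross_superadd)
  finally show ?thesis .
qed

lemma eventually_weighted_mass_add:
  assumes "f \<in> borel_measurable borel" "a \<le> b" "b \<le> d"
    and "\<forall>\<^sub>F c in at_right 0. ennreal r \<le> weighted_mass f c a b" "\<forall>\<^sub>F c in at_right 0. ennreal r' \<le> weighted_mass f c b d"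
  shows "\<forall>\<^sub>F c in at_right 0. ennreal (r + r') \<le> weighted_mass f c a d"
  using assms(4,5)
proof eventually_elim
  case (elim c)
  \<comment> \<open>Only an inequality, since \<open>ennreal\<close> sends negative reals to
    0.\<close>
  have "ennreal (r + r') \<le> ennreal r + ennreal r'"
    by (cases "0 \<le> r"; cases "0 \<le> r'") (auto simp: ennreal_plus[symmetric] ennreal_neg intro: ennreal_leI simp del: ennreal_plus)
  also have "\<dots> \<le> weighted_mass f c a b + weighted_mass f c b d" using elim by (rule add_mono)
  also have "\<dots> \<le> weighted_mass f c a d" by (rule weighted_mass_superadd[OF assms(1-3)])
  finally show ?case .
qed

text \<open>All crossed levels lie in \<open>I\<close>, where the weight is at least
  \<open>m\<close>, so \<open>mass_lower\<close> carries over.\<close>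

lemma eventually_weighted_mass_local:
  assumes ab: "0 \<le> a" "a \<le> b" and I: "x ` {a..b} \<subseteq> I" "is_interval I"
    and f: "\<And>y. 0 \<le> f y" "\<And>y. y \<in> I \<Longrightarrow> m \<le> f y" and \<delta>: "0 < \<delta>"
  shows "\<forall>\<^sub>F c in at_right 0. ennreal (m * (C * (b - a)) - \<delta>) \<le> weighted_mass f c a b"
proof -
  \<comment> \<open>\<open>m\<close> may be negative; \<open>m'\<close> is still a lower bound on
    \<open>I\<close> and can serve as a factor in \<open>ennreal\<close>. The tolerance
    \<open>\<delta> / (m' + 1)\<close> stays below \<delta> when multiplied by
    \<open>m'\<close>.\<close>
  define m' where "m' = max m 0"
  have m': "0 \<le> m'" "m \<le> m'" "\<And>y. y \<in> I \<Longrightarrow> m' \<le> f y" using f by (auto simp: m'_def)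
  have "0 < \<delta> / (m' + 1)" using \<delta> m' by simp
  from mass_lower[OF ab this] eventually_at_right_less[of 0] show ?thesis
  proof eventually_elim
    case (elim c)
    have "m' * (\<delta> / (m' + 1)) \<le> \<delta>" using \<delta> m' by (simp add: field_simps)
    moreover have "m * (C * (b - a)) \<le> m' * (C * (b - a))"
      using C ab by (intro mult_right_mono[OF m'(2)]) simp
    ultimately have "m * (C * (b - a)) - \<delta> \<le> m' * (C * (b - a) - \<delta> / (m' + 1))"
      unfolding right_diff_distrib[of m'] by linarith
    then have "ennreal (m * (C * (b - a)) - \<delta>) \<le> ennreal m' * ennreal (C * (b - a) - \<delta> / (m' + 1))"
      using m'(1) by (subst ennreal_mult'[symmetric]) (auto intro: ennreal_leI)
    also have "\<dots> \<le> ennreal m' * (ennreal (c powr \<gamma>) * (\<integral>\<^sup>+y. ncross c x a b y \<partial>lborel))"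
      using elim by (intro mult_left_mono) auto
    also have "\<dots> = ennreal (c powr \<gamma>) * (\<integral>\<^sup>+y. ennreal m' * ncross c x a b y \<partial>lborel)"
      by (subst nn_integral_cmult) (auto simp: ac_simps)
    also have "\<dots> \<le> weighted_mass f c a b"
      unfolding weighted_mass_def
    proof (intro mult_left_mono nn_integral_mono)
      fix y
      show "ennreal m' * ncross c x a b y \<le> ennreal (f y) * ncross c x a b y"
      proof (cases "y \<in> I")
        case True
        then show ?thesis using m'(3) by (intro mult_right_mono ennreal_leI) auto
      next
        case False
        then show ?thesis using ncross_eq_0[OF _ I False, of c] elim by simp
      qed
    qed simp
    finally show ?case .
  qed
qed

text \<open>Replacing the weight by \<open>l - e\<close> in the mass and by \<open>l + e\<close> in
  the time integral costs \<open>2 * C * e * (b - a)\<close>, which is at most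
  \<open>\<epsilon> * (b - a)\<close>.\<close>

lemma eventually_weighted_mass_piece:
  assumes f: "f \<in> borel_measurable borel" "\<And>y. 0 \<le> f y" "\<And>y. f y \<le> B"
    and ab: "0 \<le> a" "a \<le> b" and I: "x ` {a..b} \<subseteq> I" "is_interval I"
    and osc: "\<And>y. y \<in> I \<Longrightarrow> \<bar>f y - l\<bar> \<le> e" and e: "2 * C * e \<le> \<epsilon>" and \<delta>: "0 < \<delta>"
  shows "\<forall>\<^sub>F c in at_right 0.
    ennreal (C * integral {a..b} (\<lambda>s. f (x s)) - \<epsilon> * (b - a) - \<delta>) \<le> weighted_mass f c a b"
proof -
  have fB: "\<bar>f y\<bar> \<le> B" for y using f(2,3)[of y] by simp
  have "integral {a..b} (\<lambda>s. f (x s)) \<le> integral {a..b} (\<lambda>s. l + e)"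
  proof (rule integral_le[OF integrable_comp(2)[OF cadlag f(1) fB ab(1)]])
    fix s assume "s \<in> {a..b}"
    then have "\<bar>f (x s) - l\<bar> \<le> e" using osc I by blast
    then show "f (x s) \<le> l + e" by linarith
  qed (rule integrable_const_ivl)
  also have "\<dots> = (l + e) * (b - a)" using ab by simp
  finally have "C * integral {a..b} (\<lambda>s. f (x s)) \<le> C * ((l + e) * (b - a))"
    using C by (rule mult_left_mono)
  moreover have "2 * C * e * (b - a) \<le> \<epsilon> * (b - a)" using e ab by (intro mult_right_mono) auto
  ultimately have le: "C * integral {a..b} (\<lambda>s. f (x s)) - \<epsilon> * (b - a) - \<delta> \<le> (l - e) * (C * (b - a)) - \<delta>"
    by (simp add: algebra_simps)
  have "\<forall>\<^sub>F c in at_right 0. ennreal ((l - e) * (C * (b - a)) - \<delta>) \<le> weighted_mass f c a b"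
  proof (rule eventually_weighted_mass_local[OF ab I f(2) _ \<delta>])
    fix y assume "y \<in> I"
    then show "l - e \<le> f y" using osc[of y] by linarith
  qed
  then show ?thesis
    by eventually_elim (rule order_trans[OF ennreal_leI[OF le]])
qed

lemma eventually_weighted_mass_lower:
  assumes cont: "continuous_on UNIV f" and f: "\<And>y. 0 \<le> f y" "\<And>y. f y \<le> B"
    and T: "0 \<le> T" and \<epsilon>: "0 < \<epsilon>"
  shows "\<And>\<delta>. 0 < \<delta> \<Longrightarrow> \<forall>\<^sub>F c in at_right 0.
    ennreal (C * integral {0..T} (\<lambda>s. f (x s)) - \<epsilon> * T - \<delta>) \<le> weighted_mass f c 0 T"
proof -
  let ?g = "\<lambda>s. f (x s)"
  have meas: "f \<in> borel_measurable borel" using cont by (rule borel_measurable_continuous_onI)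
  have fB: "\<bar>f y\<bar> \<le> B" for y using f(1,2)[of y] by simp
  have B: "0 \<le> B" using fB[of 0] by linarith
  have int: "?g integrable_on {a..b}" if "0 \<le> a" for a b
    by (rule integrable_comp(2)[OF cadlag meas fB that])
  have comb: "integral {a..d} ?g = integral {a..b} ?g + integral {b..d} ?g" if "0 \<le> a" "a \<le> b" "b \<le> d" for a b d
    using Henstock_Kurzweil_Integration.integral_combine[of a b d ?g] int that by simp
  \<comment> \<open>The error part proportional to the length adds up exactly when intervals are
    joined; the arbitrary \<delta> can be halved at each join. The guards confine \<open>P\<close>
    to the time domain.\<close>
  define P where "P a b \<longleftrightarrow> (0 \<le> a \<longrightarrow> b \<le> T \<longrightarrow> (\<forall>\<delta>>0. \<forall>\<^sub>F c in at_right 0.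
      ennreal (C * integral {a..b} ?g - \<epsilon> * (b - a) - \<delta>) \<le> weighted_mass f c a b))" for a b
  have trans: "P a d" if P: "P a b" "P b d" and le: "a \<le> b" "b \<le> d" for a b d
    unfolding P_def
  proof (intro impI allI)
    fix \<delta> :: real assume a: "0 \<le> a" "d \<le> T" and \<delta>: "0 < \<delta>"
    have "\<forall>\<^sub>F c in at_right 0. ennreal (C * integral {a..b} ?g - \<epsilon> * (b - a) - \<delta>/2) \<le> weighted_mass f c a b"
      "\<forall>\<^sub>F c in at_right 0. ennreal (C * integral {b..d} ?g - \<epsilon> * (d - b) - \<delta>/2) \<le> weighted_mass f c b d"
      using P a le \<delta> by (auto simp: P_def)
    from eventually_weighted_mass_add[OF meas le this] comb[OF a(1) le]
    show "\<forall>\<^sub>F c in at_right 0. ennreal (C * integral {a..d} ?g - \<epsilon> * (d - a) - \<delta>) \<le> weighted_mass f c a d"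
      by (simp add: algebra_simps)
  qed
  have refl: "P p p" for p
    by (auto simp: P_def ennreal_neg)
  \<comment> \<open>\<open>C + 1\<close> instead of \<open>C\<close> keeps the quotient meaningful
    for \<open>C = 0\<close>.\<close>
  define e where "e = \<epsilon> / (2 * (C + 1))"
  have e: "0 < e" "2 * C * e \<le> \<epsilon>" using \<epsilon> C by (auto simp: e_def field_simps)
  have near: "\<exists>r>0. \<forall>y\<in>ball l r. \<bar>f y - f l\<bar> \<le> e" for l
  proof -
    have "continuous (at l) f" using cont by (simp add: continuous_on_eq_continuous_at)
    then obtain r where "r > 0" "\<forall>y. dist y l < r \<longrightarrow> dist (f y) (f l) < e"
      using e(1) unfolding continuous_at_eps_delta by (metis dist_real_def)
    then show ?thesis by (intro exI[of _ r]) (auto simp: dist_commute dist_real_def less_imp_le)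
  qed
  have ball: "is_interval (ball l r)" for l r :: real by (simp add: ball_eq_greaterThanLessThan is_interval_oo)
  have right: "\<exists>d>0. \<forall>b. p \<le> b \<longrightarrow> b < p + d \<longrightarrow> P p b" if p: "0 \<le> p" for p
  proof -
    obtain r where r: "r > 0" "\<forall>y\<in>ball (x p) r. \<bar>f y - f (x p)\<bar> \<le> e" using near by blast
    have "(x \<longlongrightarrow> x p) (at_right p)" using cadlag p by (simp add: cadlag_def)
    then have "\<forall>\<^sub>F u in at_right p. dist (x u) (x p) < r" using r(1) by (rule tendstoD)
    then obtain b where b: "p < b" "\<And>u. p < u \<Longrightarrow> u < b \<Longrightarrow> dist (x u) (x p) < r"
      by (auto simp: eventually_at_right_field)
    have "P p b'" if b': "p \<le> b'" "b' < p + (b - p)" for b'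
    proof -
      have "x ` {p..b'} \<subseteq> ball (x p) r"
      proof clarify
        fix u assume "u \<in> {p..b'}"
        then show "x u \<in> ball (x p) r" using b(2)[of u] b' r(1) by (cases "u = p") (auto simp: dist_commute)
      qed
      then show ?thesis unfolding P_def
        using eventually_weighted_mass_piece[OF meas f _ b'(1) _ ball _ e(2), of "x p" r "f (x p)"] r(2) by auto
    qed
    then show ?thesis using b(1) by (intro exI[of _ "b - p"]) auto
  qed
  have left: "\<exists>d>0. \<forall>a. a \<le> p \<longrightarrow> p - d < a \<longrightarrow> P a p" for p
  proof (cases "0 < p")
    \<comment> \<open>For \<open>p\<close> not positive the guard leaves only
      \<open>a = p = 0\<close>.\<close>
    case False
    then show ?thesis using refl by (intro exI[of _ 1]) (auto simp: P_def dest: order_antisym)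
  next
    case True
    then obtain l where l: "(x \<longlongrightarrow> l) (at_left p)" using cadlag by (auto simp: cadlag_def)
    obtain r where r: "r > 0" "\<forall>y\<in>ball l r. \<bar>f y - f l\<bar> \<le> e" using near by blast
    have "\<forall>\<^sub>F u in at_left p. dist (x u) l < r" using l r(1) by (rule tendstoD)
    then obtain b where b: "b < p" "\<And>u. b < u \<Longrightarrow> u < p \<Longrightarrow> dist (x u) l < r"
      by (auto simp: eventually_at_left_field)
    have "P a p" if a: "a \<le> p" "p - (p - b) < a" for a
    proof (cases "a = p")
      case True
      then show ?thesis using refl by simp
    next
      case False
      with a have ap: "a < p" by simp
      show ?thesis unfolding P_def
      proof (intro impI allI)
        fix \<delta> :: real assume a0: "0 \<le> a" and "p \<le> T" and \<delta>: "0 < \<delta>"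
        \<comment> \<open>The left limit controls the values only before \<open>p\<close>, so the
          estimate stops at \<open>q\<close>. The omitted piece changes \<open>C\<close> times the
          time integral by at most \<open>C * B * (p - q)\<close>, hence by at most
          \<open>\<delta>/2\<close>.\<close>
        define q where "q = max a (p - \<delta> / (2 * (C * B + 1)))"
        have CB: "0 \<le> C * B" using C B by simp
        have \<eta>: "0 < \<delta> / (2 * (C * B + 1))" using \<delta> CB by simp
        have q: "a \<le> q" "q < p" using ap \<eta> by (auto simp: q_def)
        have "C * B * (p - q) \<le> C * B * (\<delta> / (2 * (C * B + 1)))"
          using CB by (intro mult_left_mono) (auto simp: q_def)
        also have "\<dots> \<le> \<delta>/2" using \<delta> CB by (simp add: field_simps)
        finally have small: "C * (B * (p - q)) \<le> \<delta>/2" by (simp add: ac_simps)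
        have "x ` {a..q} \<subseteq> ball l r"
          using b(2) q a by (force simp: dist_commute)
        then have ev: "\<forall>\<^sub>F c in at_right 0. ennreal (C * integral {a..q} ?g - \<epsilon> * (q - a) - \<delta>/2) \<le> weighted_mass f c a q"
          using eventually_weighted_mass_piece[OF meas f a0 q(1) _ ball _ e(2), of l r "f l"] r(2) \<delta> by auto
        have "integral {q..p} ?g \<le> integral {q..p} (\<lambda>s. B)"
          by (rule integral_le[OF int integrable_const_ivl]) (use a0 q f in auto)
        then have "C * integral {q..p} ?g \<le> C * (B * (p - q))"
          using q C by (intro mult_left_mono) (auto simp: mult.commute)
        moreover have "\<epsilon> * (q - a) \<le> \<epsilon> * (p - a)" using q \<epsilon> by simp
        ultimately have le: "C * integral {a..p} ?g - \<epsilon> * (p - a) - \<delta> \<le> C * integral {a..q} ?g - \<epsilon> * (q - a) - \<delta>/2"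
          using comb[of a q p] a0 q small by (simp add: algebra_simps)
        from ev show "\<forall>\<^sub>F c in at_right 0. ennreal (C * integral {a..p} ?g - \<epsilon> * (p - a) - \<delta>) \<le> weighted_mass f c a p"
        proof eventually_elim
          case (elim c)
          have "ennreal (C * integral {a..p} ?g - \<epsilon> * (p - a) - \<delta>) \<le> weighted_mass f c a q"
            using elim by (rule order_trans[OF ennreal_leI[OF le]])
          also have "\<dots> \<le> weighted_mass f c a q + weighted_mass f c q p" by simp
          also have "\<dots> \<le> weighted_mass f c a p" using q by (intro weighted_mass_superadd meas) auto
          finally show ?case .
        qed
      qed
    qed
    then show ?thesis using b(1) by (intro exI[of _ "p - b"]) auto
  qed
  have "P 0 T"
  \<comment> \<open>Local to global by bisection: \<open>P\<close> is transitive and holds on all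
    short intervals around each point, since such an interval can be split at that point.\<close>
  proof (rule Bolzano[OF T])
    fix p assume p: "0 \<le> p" "p \<le> T"
    obtain d1 where d1: "d1 > 0" "\<And>b. p \<le> b \<Longrightarrow> b < p + d1 \<Longrightarrow> P p b" using right[OF p(1)] by blast
    obtain d2 where d2: "d2 > 0" "\<And>a. a \<le> p \<Longrightarrow> p - d2 < a \<Longrightarrow> P a p" using left by blast
    have "P a b" if "a \<le> p" "p \<le> b" "b - a < min d1 d2" for a b
      using trans[of a p b] d1(2)[of b] d2(2)[of a] that by simp
    then show "\<exists>d>0. \<forall>a b. a \<le> p \<and> p \<le> b \<and> b - a < d \<longrightarrow> P a b"
      using d1(1) d2(1) by (intro exI[of _ "min d1 d2"]) auto
  qed (rule trans)
  then show "\<And>\<delta>. 0 < \<delta> \<Longrightarrow> \<forall>\<^sub>F c in at_right 0.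
      ennreal (C * integral {0..T} ?g - \<epsilon> * T - \<delta>) \<le> weighted_mass f c 0 T"
    using T by (simp add: P_def)
qed

end

section \<open>Weak convergence along a path\<close>

context tv_limit begin

lemma eventually_density_crossings:
  assumes T: "0 \<le> T"
  shows "\<forall>\<^sub>F c in at_right 0. density lborel (\<lambda>y. ennreal (c powr \<gamma> * real (crossings y c x 0 T))) =
    density lborel (\<lambda>y. ennreal (c powr \<gamma>) * ncross c x 0 T y)"
proof -
  have lim: "filterlim (\<lambda>c. c / 2) (at_right 0) (at_right (0::real))"
    using filterlim_times_pos[of "\<lambda>c::real. c" 0 "at_right 0" "1/2"] by (simp add: filterlim_ident)
  from eventually_at_right_less[of 0] eventually_compose_filterlim[OF tv_finite[OF T] lim]
  show ?thesis
  proof eventually_elim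
    case (elim c)
    then have "ennreal (real (crossings y c x 0 T)) = ncross c x 0 T y" for y
      using ennreal_crossings[OF cadlag T, of "c/2" c y] by (simp add: ennreal_of_nat_eq_real_of_nat)
    then show ?case by (simp add: ennreal_mult')
  qed
qed

text \<open>The weight \<open>B + f\<close> is nonnegative, so the previous section applies to it;
  \<open>B\<close> times the total mass is then subtracted, using \<open>mass_upper\<close>.\<close>

lemma crossing_integral_lower:
  assumes cont: "continuous_on UNIV f" and B: "0 < B" "\<And>y. \<bar>f y\<bar> \<le> B" and T: "0 \<le> T" and e: "0 < e"
  shows "\<forall>\<^sub>F c in at_right 0. C * integral {0..T} (\<lambda>s. f (x s)) - e
    \<le> (\<integral>y. f y \<partial>density lborel (\<lambda>y. ennreal (c powr \<gamma>) * ncross c x 0 T y))"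
proof -
  have [measurable]: "f \<in> borel_measurable borel" using cont by (rule borel_measurable_continuous_onI)
  \<comment> \<open>Error budget: \<delta> for \<open>\<epsilon> * T\<close>, \<delta> for the slack
    of the weighted bound and \<open>B * \<delta>\<close> for the total mass, together
    \<open>e\<close>.\<close>
  define \<delta> where "\<delta> = e / (2 + B)"
  define \<epsilon> where "\<epsilon> = \<delta> / (T + 1)"
  have \<delta>: "0 < \<delta>" using e B by (simp add: \<delta>_def)
  have \<epsilon>: "0 < \<epsilon>" "\<epsilon> * T \<le> \<delta>" using \<delta> T by (auto simp: \<epsilon>_def field_simps)
  have e_eq: "e = 2 * \<delta> + B * \<delta>" 
  proof -
    have "(2 + B) * \<delta> = e" using B by (simp add: \<delta>_def)
    then show ?thesis by (simp add: algebra_simps)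
  qed
  have fB: "0 \<le> B + f y" "B + f y \<le> 2 * B" for y using B(2)[of y] by auto
  have int: "(\<lambda>s. f (x s)) integrable_on {0..T}" by (rule integrable_comp(2)[OF cadlag _ B(2)]) auto
  have J: "integral {0..T} (\<lambda>s. B + f (x s)) = B * T + integral {0..T} (\<lambda>s. f (x s))"
    using Henstock_Kurzweil_Integration.integral_add[OF integrable_const_ivl int] T by simp
  have "\<forall>\<^sub>F c in at_right 0. ennreal (C * integral {0..T} (\<lambda>s. B + f (x s)) - \<epsilon> * T - \<delta>) \<le> weighted_mass (\<lambda>y. B + f y) c 0 T"
    using cont by (intro eventually_weighted_mass_lower[OF _ fB T \<epsilon>(1) \<delta>] continuous_intros)
  with mass_upper[OF T \<delta>] show ?thesis
  proof eventually_elim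
    case (elim c)
    define \<nu> where "\<nu> = density lborel (\<lambda>y. ennreal (c powr \<gamma>) * ncross c x 0 T y)"
    have mass: "emeasure \<nu> (space \<nu>) = ennreal (c powr \<gamma>) * (\<integral>\<^sup>+y. ncross c x 0 T y \<partial>lborel)"
      unfolding \<nu>_def by (subst emeasure_density) (auto simp: nn_integral_cmult)
    interpret finite_measure \<nu>
      by (rule finite_measureI) (use mass elim in \<open>auto simp: top_unique\<close>)
    have [simp]: "sets \<nu> = sets borel" by (simp add: \<nu>_def)
    have meas: "measure \<nu> (space \<nu>) \<le> C * T + \<delta>"
      unfolding measure_def mass using elim C T \<delta> by (intro enn2real_leI) auto
    have fi: "integrable \<nu> f"
      by (rule integrable_const_bound[of _ B]) (use B in \<open>auto simp: \<nu>_def\<close>)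
    have "(\<integral>\<^sup>+y. ennreal (B + f y) \<partial>\<nu>) = weighted_mass (\<lambda>y. B + f y) c 0 T"
      unfolding \<nu>_def weighted_mass_def
      by (subst nn_integral_density) (auto simp: nn_integral_cmult[symmetric] ac_simps)
    moreover have "(\<integral>\<^sup>+y. ennreal (B + f y) \<partial>\<nu>) = ennreal (\<integral>y. B + f y \<partial>\<nu>)"
      using fi fB by (intro nn_integral_eq_integral) auto
    ultimately have "ennreal (C * integral {0..T} (\<lambda>s. B + f (x s)) - \<epsilon> * T - \<delta>) \<le> ennreal (\<integral>y. B + f y \<partial>\<nu>)"
      using elim by simp
    moreover have "0 \<le> (\<integral>y. B + f y \<partial>\<nu>)" using fB by (intro integral_nonneg_AE) auto
    ultimately have "C * integral {0..T} (\<lambda>s. B + f (x s)) - \<epsilon> * T - \<delta> \<le> (\<integral>y. B + f y \<partial>\<nu>)"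
      by (simp add: ennreal_le_iff)
    also have "\<dots> = B * measure \<nu> (space \<nu>) + (\<integral>y. f y \<partial>\<nu>)"
      using fi by simp
    also have "B * measure \<nu> (space \<nu>) \<le> B * (C * T + \<delta>)"
      using meas B(1) by (intro mult_left_mono) auto
    finally have "C * (B * T + integral {0..T} (\<lambda>s. f (x s))) - \<epsilon> * T - \<delta> \<le> B * (C * T + \<delta>) + (\<integral>y. f y \<partial>\<nu>)"
      by (simp add: J)
    then have "C * integral {0..T} (\<lambda>s. f (x s)) - e \<le> (\<integral>y. f y \<partial>\<nu>)"
      using \<epsilon>(2) unfolding e_eq by (simp add: algebra_simps)
    then show ?case by (simp add: \<nu>_def)
  qed
qed

text \<open>The lower bounds for \<open>f\<close> and for \<open>- f\<close> give both sides of the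
  limit.\<close>

lemma crossings_weakly_converge:
  assumes T: "0 \<le> T" and \<mu>: "finite_borel_measure \<mu>"
    and int: "\<And>f :: real \<Rightarrow> real. continuous_on UNIV f \<Longrightarrow> bounded (range f) \<Longrightarrow>
      (\<integral>y. f y \<partial>\<mu>) = C * integral {0..T} (\<lambda>s. f (x s))"
  shows "weakly_converges (\<lambda>c. density lborel (\<lambda>y. ennreal (c powr \<gamma> * real (crossings y c x 0 T)))) \<mu> (at_right 0)"
proof -
  define \<nu> where "\<nu> c = density lborel (\<lambda>y. ennreal (c powr \<gamma>) * ncross c x 0 T y)" for c
  note eq = eventually_density_crossings[OF T, folded \<nu>_def]
  have "\<forall>\<^sub>F c in at_right 0. finite_borel_measure (\<nu> c)"
    using mass_upper[OF T, of 1, simplified]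
  proof eventually_elim
    case (elim c)
    have "emeasure (\<nu> c) (space (\<nu> c)) = ennreal (c powr \<gamma>) * (\<integral>\<^sup>+y. ncross c x 0 T y \<partial>lborel)"
      unfolding \<nu>_def by (subst emeasure_density) (auto simp: nn_integral_cmult)
    then interpret finite_measure "\<nu> c"
      by (intro finite_measureI) (use elim in \<open>auto simp: top_unique\<close>)
    show ?case by unfold_locales (simp add: \<nu>_def)
  qed
  with eq have fin: "\<forall>\<^sub>F c in at_right 0. finite_borel_measure (density lborel (\<lambda>y. ennreal (c powr \<gamma> * real (crossings y c x 0 T))))"
    by eventually_elim simp
  have "((\<lambda>c. \<integral>y. f y \<partial>\<nu> c) \<longlongrightarrow> (\<integral>y. f y \<partial>\<mu>)) (at_right 0)"
    if f: "continuous_on UNIV f" "bounded (range f)" for f :: "real \<Rightarrow> real"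
  proof (rule tendstoI)
    fix e :: real assume e: "0 < e"
    obtain B where B: "0 < B" "\<And>y. \<bar>f y\<bar> \<le> B" using f(2) by (auto simp: bounded_pos)
    have e2: "0 < e / 2" using e by simp
    have "\<forall>\<^sub>F c in at_right 0. C * integral {0..T} (\<lambda>s. f (x s)) - e/2 \<le> (\<integral>y. f y \<partial>\<nu> c)"
      unfolding \<nu>_def by (rule crossing_integral_lower[OF f(1) B T e2])
    moreover have "\<forall>\<^sub>F c in at_right 0. C * integral {0..T} (\<lambda>s. - f (x s)) - e/2 \<le> (\<integral>y. - f y \<partial>\<nu> c)"
      unfolding \<nu>_def
      by (rule crossing_integral_lower[OF _ B(1) _ T e2]) (use f(1) B in \<open>auto intro: continuous_intros\<close>)
    ultimately show "\<forall>\<^sub>F c in at_right 0. dist (\<integral>y. f y \<partial>\<nu> c) (\<integral>y. f y \<partial>\<mu>) < e"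
    proof eventually_elim
      case (elim c)
      then show ?case using e by (simp add: int[OF f] dist_real_def)
    qed
  qed
  then have "((\<lambda>c. \<integral>y. f y \<partial>density lborel (\<lambda>y. ennreal (c powr \<gamma> * real (crossings y c x 0 T)))) \<longlongrightarrow> (\<integral>y. f y \<partial>\<mu>)) (at_right 0)"
    if f: "continuous_on UNIV f" "bounded (range f)" for f :: "real \<Rightarrow> real"
    by (rule Lim_transform_eventually) (use f eq in \<open>auto elim: eventually_mono\<close>)
  then show ?thesis using fin \<mu> by (simp add: weakly_converges_def)
qed

end

section \<open>Occupation measure and local time\<close>

lemma cadlag_measurable_restrict:
  assumes "cadlag x" shows "x \<in> borel_measurable (restrict_space lborel {0..t})"
proof -
  have "(\<lambda>s. x (max 0 s)) \<in> borel_measurable (restrict_space lborel {0..t})"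
    using cadlag_measurable[OF assms] by (intro measurable_restrict_space1) simp
  then show ?thesis
    by (rule measurable_cong[THEN iffD1, rotated]) (simp add: space_restrict_space)
qed

text \<open>The density with the Radon-Nikodym derivative is again the occupation measure, whose
  integrals are time integrals along the path. The total mass is \<open>C * t\<close>.\<close>

lemma integral_local_time:
  assumes x: "cadlag (\<lambda>s. X s \<omega>)" and ac: "absolutely_continuous lborel (occupation_measure X t \<omega>)"
    and C: "0 \<le> C" and t: "0 \<le> t"
  shows "finite_borel_measure (density lborel (\<lambda>y. ennreal C * local_time X t \<omega> y))"
    and "\<And>f :: real \<Rightarrow> real. continuous_on UNIV f \<Longrightarrow> bounded (range f) \<Longrightarrow>
      (\<integral>y. f y \<partial>density lborel (\<lambda>y. ennreal C * local_time X t \<omega> y)) = C * integral {0..t} (\<lambda>s. f (X s \<omega>))"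
proof -
  let ?O = "occupation_measure X t \<omega>"
  have [measurable]: "(\<lambda>s. X s \<omega>) \<in> borel_measurable (restrict_space lborel {0..t})"
    by (rule cadlag_measurable_restrict[OF x])
  have sO: "sets ?O = sets borel" by (simp add: occupation_measure_def)
  have "density lborel (\<lambda>y. ennreal C * local_time X t \<omega> y)
      = density (density lborel (RN_deriv lborel ?O)) (\<lambda>_. ennreal C)"
    unfolding local_time_def by (subst density_density_eq) (auto simp: ac_simps)
  also have "density lborel (RN_deriv lborel ?O) = ?O"
    using ac sO by (intro sigma_finite_measure.density_RN_deriv sigma_finite_lborel) auto
  finally have eq: "density lborel (\<lambda>y. ennreal C * local_time X t \<omega> y) = density ?O (\<lambda>_. ennreal C)" .
  have "emeasure ?O UNIV = ennreal t"
    using t unfolding occupation_measure_def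
    by (subst emeasure_distr) (auto simp: space_restrict_space emeasure_restrict_space)
  then have "emeasure (density ?O (\<lambda>_. ennreal C)) UNIV = ennreal C * ennreal t"
    using sO by (subst emeasure_density_const) auto
  then interpret finite_measure "density ?O (\<lambda>_. ennreal C)"
    by (intro finite_measureI) (use sets_eq_imp_space_eq[OF sO] in \<open>auto simp: ennreal_mult[symmetric] C t\<close>)
  show "finite_borel_measure (density lborel (\<lambda>y. ennreal C * local_time X t \<omega> y))"
    unfolding eq by unfold_locales (simp add: sO)
  fix f :: "real \<Rightarrow> real" assume f: "continuous_on UNIV f" "bounded (range f)"
  have [measurable]: "f \<in> borel_measurable borel" using f(1) by (rule borel_measurable_continuous_onI)
  obtain B where B: "\<And>y. \<bar>f y\<bar> \<le> B" using f(2) by (auto simp: bounded_iff)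
  have fO: "f \<in> borel_measurable ?O" using sO by (simp cong: measurable_cong_sets)
  have "(\<integral>y. f y \<partial>density ?O (\<lambda>_. ennreal C)) = (\<integral>y. C *\<^sub>R f y \<partial>?O)"
    using C fO by (intro integral_density) auto
  also have "\<dots> = C * (\<integral>y. f y \<partial>?O)" by simp
  also have "(\<integral>y. f y \<partial>?O) = (\<integral>s. f (X s \<omega>) \<partial>restrict_space lborel {0..t})"
    unfolding occupation_measure_def by (rule integral_distr) auto
  also have "\<dots> = (LINT s:{0..t}|lborel. f (X s \<omega>))"
    unfolding set_lebesgue_integral_def by (subst integral_restrict_space) auto
  also have "\<dots> = (LINT s:{0..t}|lborel. f (X (max 0 s) \<omega>))"
    by (rule set_lebesgue_integral_cong) auto
  also have "\<dots> = integral {0..t} (\<lambda>s. f (X s \<omega>))"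
    by (rule integrable_comp(3)[OF x _ B]) auto
  finally show "(\<integral>y. f y \<partial>density lborel (\<lambda>y. ennreal C * local_time X t \<omega> y)) = C * integral {0..t} (\<lambda>s. f (X s \<omega>))"
    unfolding eq .
qed

section \<open>The almost sure statement\<close>

text \<open>The occupation measure grows with time. Absolute continuity at the natural times thus
  gives it at all times, outside a single null set.\<close>

lemma absolutely_continuous_occupation_mono:
  assumes x: "cadlag (\<lambda>s. X s \<omega>)" and t: "0 \<le> t" "t \<le> u"
    and ac: "absolutely_continuous lborel (occupation_measure X u \<omega>)"
  shows "absolutely_continuous lborel (occupation_measure X t \<omega>)"
  unfolding absolutely_continuous_def
proof
  fix A assume A: "A \<in> null_sets (lborel :: real measure)"
  have em: "emeasure (occupation_measure X v \<omega>) A = emeasure lborel ((\<lambda>s. X s \<omega>) -` A \<inter> {0..v})"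
    and meas: "(\<lambda>s. X s \<omega>) -` A \<inter> {0..v} \<in> sets lborel" for v
  proof -
    have m: "(\<lambda>s. X s \<omega>) \<in> borel_measurable (restrict_space lborel {0..v})"
      by (rule cadlag_measurable_restrict[OF x])
    have Ab: "A \<in> sets borel" using A by auto
    have "(\<lambda>s. X s \<omega>) -` A \<inter> space (restrict_space lborel {0..v}) \<in> sets (restrict_space lborel {0..v})"
      by (rule measurable_sets[OF m Ab])
    then show "(\<lambda>s. X s \<omega>) -` A \<inter> {0..v} \<in> sets lborel"
      by (subst (asm) sets_restrict_space_iff) (auto simp: space_restrict_space)
    show "emeasure (occupation_measure X v \<omega>) A = emeasure lborel ((\<lambda>s. X s \<omega>) -` A \<inter> {0..v})"
      unfolding occupation_measure_def
      by (subst emeasure_distr[OF m Ab]) (auto simp: space_restrict_space intro!: emeasure_restrict_space)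
  qed
  have "emeasure (occupation_measure X t \<omega>) A \<le> emeasure (occupation_measure X u \<omega>) A"
    unfolding em using t meas by (intro emeasure_mono) auto
  also have "emeasure (occupation_measure X u \<omega>) A = 0"
    using ac A unfolding absolutely_continuous_def by (auto dest: null_setsD1)
  finally show "A \<in> null_sets (occupation_measure X t \<omega>)"
    using A by (intro null_setsI) (auto simp: occupation_measure_def)
qed

text \<open>Truncated variation is monotone in \<open>t\<close> and the limit is continuous in
  \<open>t\<close>, so rational times on either side of \<open>t\<close> squeeze it.\<close>

lemma truncated_variation_tendsto_of_rational:
  assumes rat: "\<And>q. q \<in> \<rat> \<Longrightarrow> 0 \<le> q \<Longrightarrow>
      ((\<lambda>c. ereal (c powr \<gamma>) * truncated_variation c x 0 q) \<longlongrightarrow> ereal (C * q)) (at_right 0)"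
    and t: "0 \<le> t"
  shows "((\<lambda>c. ereal (c powr \<gamma>) * truncated_variation c x 0 t) \<longlongrightarrow> ereal (C * t)) (at_right 0)"
proof (cases "t = 0")
  case True
  then show ?thesis using rat[of 0] by simp
next
  case False
  with t have t: "0 < t" by simp
  have mono: "ereal (c powr \<gamma>) * truncated_variation c x 0 u \<le> ereal (c powr \<gamma>) * truncated_variation c x 0 v"
    if "0 \<le> u" "u \<le> v" "0 < c" for c u v
    using that by (intro ereal_mult_left_mono truncated_variation_mono) auto
  have lim: "((\<lambda>q. ereal (C * q)) \<longlongrightarrow> ereal (C * t)) (at t within S)" for S
    by (intro tendsto_intros)
  show ?thesis
  proof (rule order_tendstoI)
    fix l assume "l < ereal (C * t)"
    then have "\<forall>\<^sub>F q in at_left t. l < ereal (C * q)" using order_tendstoD(1)[OF lim] by blast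
    then obtain b where b: "b < t" "\<And>q. b < q \<Longrightarrow> q < t \<Longrightarrow> l < ereal (C * q)"
      by (auto simp: eventually_at_left_field)
    obtain q where q: "q \<in> \<rat>" "max b 0 < q" "q < t" using Rats_dense_in_real[of "max b 0" t] b t by auto
    have "\<forall>\<^sub>F c in at_right 0. l < ereal (c powr \<gamma>) * truncated_variation c x 0 q"
      using order_tendstoD(1)[OF rat[of q]] b(2)[of q] q by auto
    with eventually_at_right_less[of 0]
    show "\<forall>\<^sub>F c in at_right 0. l < ereal (c powr \<gamma>) * truncated_variation c x 0 t"
    proof eventually_elim
      case (elim c)
      then show ?case using mono[of q t c] q by (simp add: less_le_trans)
    qed
  next
    fix l assume "ereal (C * t) < l"
    then have "\<forall>\<^sub>F q in at_right t. ereal (C * q) < l" using order_tendstoD(2)[OF lim] by blast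
    then obtain b where b: "t < b" "\<And>q. t < q \<Longrightarrow> q < b \<Longrightarrow> ereal (C * q) < l"
      by (auto simp: eventually_at_right_field)
    obtain q where q: "q \<in> \<rat>" "t < q" "q < b" using Rats_dense_in_real[of t b] b by auto
    have "\<forall>\<^sub>F c in at_right 0. ereal (c powr \<gamma>) * truncated_variation c x 0 q < l"
      using order_tendstoD(2)[OF rat[of q]] b(2)[of q] q t by auto
    with eventually_at_right_less[of 0]
    show "\<forall>\<^sub>F c in at_right 0. ereal (c powr \<gamma>) * truncated_variation c x 0 t < l"
    proof eventually_elim
      case (elim c)
      then show ?case using mono[of t q c] q t by (simp add: le_less_trans)
    qed
  qed
qed

theorem corollary2p4:
  fixes M :: "'a measure" and X :: "real \<Rightarrow> 'a \<Rightarrow> real" and \<beta> C :: real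
  assumes "prob_space M"
    and "\<And>t. t \<ge> 0 \<Longrightarrow> X t \<in> borel_measurable M"
    and "\<And>\<omega>. \<omega> \<in> space M \<Longrightarrow> cadlag (\<lambda>t. X t \<omega>)"
    and "\<beta> > 0"
    and "\<And>t. t \<ge> 0 \<Longrightarrow> AE \<omega> in M.
           ((\<lambda>c. ereal (c powr (1 / \<beta> - 1)) * truncated_variation c (\<lambda>u. X u \<omega>) 0 t)
              \<longlongrightarrow> ereal (C * t)) (at_right 0)"
    and "has_local_time M X"
  shows "\<exists>\<Omega>\<^sub>X\<in>sets M. measure M \<Omega>\<^sub>X = 1 \<and>
           (\<forall>\<omega>\<in>\<Omega>\<^sub>X. \<forall>t\<ge>0.
              absolutely_continuous lborel (occupation_measure X t \<omega>) \<and>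
              weakly_converges
                (\<lambda>c. density lborel
                   (\<lambda>y. ennreal (c powr (1 / \<beta> - 1) * real (crossings y c (\<lambda>u. X u \<omega>) 0 t))))
                (density lborel (\<lambda>y. ennreal C * local_time X t \<omega> y))
                (at_right 0))"
proof -
  interpret prob_space M by fact
  define \<gamma> where "\<gamma> = 1 / \<beta> - 1"
  let ?conv = "\<lambda>\<omega> t. ((\<lambda>c. ereal (c powr \<gamma>) * truncated_variation c (\<lambda>u. X u \<omega>) 0 t)
              \<longlongrightarrow> ereal (C * t)) (at_right 0)"
  let ?ac = "\<lambda>\<omega> t. absolutely_continuous lborel (occupation_measure X t \<omega>)"
  \<comment> \<open>Countably many almost sure conditions, hence one exceptional null set for all
    times.\<close>
  define good where "good \<omega> \<longleftrightarrow> (\<forall>q\<in>{q \<in> \<rat>. 0 \<le> q}. ?conv \<omega> q) \<and> (\<forall>n::nat. ?ac \<omega> (real n))" for \<omega>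
  have "countable {q \<in> \<rat>. (0::real) \<le> q}"
    by (rule countable_subset[OF _ countable_rat]) auto
  then have "AE \<omega> in M. \<forall>q\<in>{q \<in> \<rat>. 0 \<le> q}. ?conv \<omega> q"
    by (subst AE_ball_countable) (simp_all add: assms(5) \<gamma>_def)
  moreover have "AE \<omega> in M. \<forall>n::nat. ?ac \<omega> (real n)"
    using assms(6) by (subst AE_all_countable) (auto simp: has_local_time_def)
  ultimately have "AE \<omega> in M. good \<omega>" unfolding good_def by (rule AE_conjI)
  then obtain N where N: "{\<omega> \<in> space M. \<not> good \<omega>} \<subseteq> N" "emeasure M N = 0" "N \<in> sets M"
    by (rule AE_E)
  have "prob N = 0" unfolding measure_def N(2) by simp
  then have "prob (space M - N) = 1" by (simp only: prob_compl[OF N(3)] diff_zero)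
  moreover have "?ac \<omega> t \<and> weakly_converges
                (\<lambda>c. density lborel (\<lambda>y. ennreal (c powr \<gamma> * real (crossings y c (\<lambda>u. X u \<omega>) 0 t))))
                (density lborel (\<lambda>y. ennreal C * local_time X t \<omega> y)) (at_right 0)"
    if \<omega>: "\<omega> \<in> space M - N" and t: "0 \<le> t" for \<omega> t
  proof -
    have x: "cadlag (\<lambda>u. X u \<omega>)" using \<omega> assms(3) by auto
    have "good \<omega>" using \<omega> N(1) by blast
    then have "\<forall>q\<in>{q \<in> \<rat>. 0 \<le> q}. ?conv \<omega> q" and ac_nat: "\<forall>n::nat. ?ac \<omega> (real n)"
      unfolding good_def by blast+
    then have rat: "?conv \<omega> q" if "q \<in> \<rat>" "0 \<le> q" for q using that by blast
    have conv: "?conv \<omega> u" if "0 \<le> u" for u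
      by (rule truncated_variation_tendsto_of_rational[OF rat that])
    have ac: "?ac \<omega> t"
      by (rule absolutely_continuous_occupation_mono[of X \<omega>, OF x t real_nat_ceiling_ge]) (use ac_nat in simp)
    have "\<forall>\<^sub>F c in at_right 0. 0 \<le> ereal (c powr \<gamma>) * truncated_variation c (\<lambda>u. X u \<omega>) 0 1"
      by (intro always_eventually allI ereal_0_le_mult truncated_variation_nonneg) auto
    \<comment> \<open>The sign of \<open>C\<close> is read off the limit at time 1 of nonnegative
      quantities.\<close>
    then have "0 \<le> ereal (C * 1)"
      by (intro tendsto_lowerbound[OF conv[of 1]]) simp_all
    then have C: "0 \<le> C" by simp
    interpret tv_limit "\<lambda>u. X u \<omega>" \<gamma> C
    proof (rule tv_limit.intro[OF x _ C conv])
      show "- 1 < \<gamma>" using assms(4) by (simp add: \<gamma>_def)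
    qed
    show ?thesis
      by (intro conjI ac crossings_weakly_converge[OF t] integral_local_time[of X \<omega>, OF x ac C t])
  qed
  ultimately show ?thesis
    unfolding \<gamma>_def using N(3) by (intro bexI[of _ "space M - N"] conjI ballI allI impI) simp_all
qed

end
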